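(* Let $n\ge 2$ and let $m_1<\cdots<m_n$ be an arithmetic sequence of positive integers, i.e. $m_i=m_1+(i-1)d$ for all $i\in\{1,\ldots,n\}$ with $d\in\mathbb{Z}^+$, and suppose $\gcd\{m_1,d\}=1$. Then $$\mathrm{reg}(K[\mathcal{C}])=\left\lceil\frac{m_n-1}{n-1}\right\rceil.$$
   Context: $K$ is an infinite field and $R=K[x_1,\ldots,x_{n+1}]$ with its standard grading. For positive integers $m_1<\cdots<m_n$, the associated projective monomial curve $\mathcal{C}\subset\mathbb{P}^n_K$ is parametrically defined by $x_i=u^{m_i}v^{m_n-m_i}$ for $1\le i\le n$ and $x_{n+1}=v^{m_n}$. Its vanishing ideal $I(\mathcal{C})\subset R$ is the kernel of the $K$-algebra homomorphism $R\to K[u,v]$, $x_i\mapsto u^{m_i}v^{m_n-m_i}$ ($1\le i\le n$), $x_{n+1}\mapsto v^{m_n}$, and $K[\mathcal{C}]=R/I(\mathcal{C})$. If $0\to\bigoplus_{j=1}^{\beta_p}R(-e_{pj})\to\cdots\to\bigoplus_{j=1}^{\beta_1}R(-e_{1j})\to R\to K[\mathcal{C}]\to0$ is a minimal graded free resolution of $K[\mathcal{C}]$ over $R$, the Castelnuovo-Mumford regularity is $\mathrm{reg}(K[\mathcal{C}])=\max\{e_{ij}-i:1\le i\le p,\ 1\le j\le\beta_i\}$. *)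

theory Defs
  imports Complex_Main "HOL-Library.Poly_Mapping" "HOL-Library.FuncSet"
begin

text \<open>
  Polynomials over \<open>'k\<close> in the variables \<open>x\<^sub>v\<close>, \<open>v :: 'v\<close>: finitely supported maps from
  exponent vectors to coefficients, multiplied by convolution.
\<close>
type_synonym ('v, 'k) mpoly = "('v \<Rightarrow>\<^sub>0 nat) \<Rightarrow>\<^sub>0 'k"

definition mconst :: "'k::comm_ring_1 \<Rightarrow> ('v, 'k) mpoly" where
  "mconst c = Poly_Mapping.single 0 c"

definition mvar :: "'v \<Rightarrow> ('v, 'k::comm_ring_1) mpoly" where
  "mvar v = Poly_Mapping.single (Poly_Mapping.single v 1) 1"

text \<open>The ring \<open>K[x\<^sub>1, \<dots>, x\<^sub>N]\<close> as a subring of the polynomials in variables indexed by \<^typ>\<open>nat\<close>.\<close>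
definition poly_ring :: "nat \<Rightarrow> (nat, 'k::comm_ring_1) mpoly set" where
  "poly_ring N = {f. \<forall>t\<in>Poly_Mapping.keys f. Poly_Mapping.keys t \<subseteq> {1..N}}"

definition irrelevant_ideal :: "nat \<Rightarrow> (nat, 'k::comm_ring_1) mpoly set" where
  "irrelevant_ideal N = {f \<in> poly_ring N. Poly_Mapping.lookup f 0 = 0}"

definition mon_degree :: "('v \<Rightarrow>\<^sub>0 nat) \<Rightarrow> nat" where
  "mon_degree t = (\<Sum>i\<in>Poly_Mapping.keys t. Poly_Mapping.lookup t i)"

text \<open>
  The zero polynomial is homogeneous of every degree; it is the only homogeneous polynomial of
  negative degree.
\<close>
definition homogeneous :: "int \<Rightarrow> ('v, 'k::comm_ring_1) mpoly \<Rightarrow> bool" where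
  "homogeneous a f \<longleftrightarrow> (\<forall>t\<in>Poly_Mapping.keys f. int (mon_degree t) = a)"

text \<open>The \<open>K\<close>-algebra homomorphism determined by \<open>x\<^sub>v \<mapsto> g v\<close>.\<close>
definition subst_hom ::
  "('v \<Rightarrow> ('w, 'k::comm_ring_1) mpoly) \<Rightarrow> ('v, 'k) mpoly \<Rightarrow> ('w, 'k) mpoly" where
  "subst_hom g f =
     (\<Sum>t\<in>Poly_Mapping.keys f. mconst (Poly_Mapping.lookup f t) *
        (\<Prod>v\<in>Poly_Mapping.keys t. g v ^ Poly_Mapping.lookup t v))"

datatype uv = U | V

text \<open>
  \<open>I(\<C>)\<close> for the projective monomial curve given by \<open>m 1 < \<dots> < m n\<close>; the ring \<open>K[u, v]\<close> is the
  type \<open>(uv, 'k) mpoly\<close>.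
\<close>
definition curve_hom :: "nat \<Rightarrow> (nat \<Rightarrow> nat) \<Rightarrow> (nat, 'k::field) mpoly \<Rightarrow> (uv, 'k) mpoly" where
  "curve_hom n m =
     subst_hom (\<lambda>i. if i = n + 1 then mvar V ^ m n else mvar U ^ m i * mvar V ^ (m n - m i))"

definition vanishing_ideal :: "nat \<Rightarrow> (nat \<Rightarrow> nat) \<Rightarrow> (nat, 'k::field) mpoly set" where
  "vanishing_ideal n m = {f \<in> poly_ring (n + 1). curve_hom n m f = 0}"

text \<open>
  The free module \<open>R\<^sup>b\<close> over \<open>R = K[x\<^sub>1, \<dots>, x\<^sub>N]\<close>: coordinate vectors indexed by \<open>1, \<dots>, b\<close>,
  extended by zero.
\<close>
definition free_module :: "nat \<Rightarrow> nat \<Rightarrow> (nat \<Rightarrow> (nat, 'k::comm_ring_1) mpoly) set" where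
  "free_module N b = {w. (\<forall>j\<in>{1..b}. w j \<in> poly_ring N) \<and> (\<forall>j. j \<notin> {1..b} \<longrightarrow> w j = 0)}"

text \<open>Homogeneity of degree \<open>a\<close> in \<open>R(-e 1) \<oplus> \<dots> \<oplus> R(-e b)\<close>, where \<open>R(-e)\<^sub>a = R\<^bsub>a - e\<^esub>\<close>.\<close>
definition homogeneous_vec ::
  "nat \<Rightarrow> (nat \<Rightarrow> int) \<Rightarrow> int \<Rightarrow> (nat \<Rightarrow> (nat, 'k::comm_ring_1) mpoly) \<Rightarrow> bool" where
  "homogeneous_vec b e a w \<longleftrightarrow> (\<forall>j\<in>{1..b}. homogeneous (a - e j) (w j))"

text \<open>
  \<open>R\<close>-linear maps \<open>R(-e 1) \<oplus> \<dots> \<oplus> R(-e b) \<rightarrow> R(-e' 1) \<oplus> \<dots> \<oplus> R(-e' b')\<close> that preserve degrees.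
\<close>
definition graded_hom ::
  "nat \<Rightarrow> nat \<Rightarrow> (nat \<Rightarrow> int) \<Rightarrow> nat \<Rightarrow> (nat \<Rightarrow> int) \<Rightarrow>
   ((nat \<Rightarrow> (nat, 'k::comm_ring_1) mpoly) \<Rightarrow> (nat \<Rightarrow> (nat, 'k) mpoly)) \<Rightarrow> bool" where
  "graded_hom N b e b' e' h \<longleftrightarrow>
     h \<in> free_module N b \<rightarrow> free_module N b' \<and>
     (\<forall>w\<in>free_module N b. \<forall>w'\<in>free_module N b. h (\<lambda>j. w j + w' j) = (\<lambda>j. h w j + h w' j)) \<and>
     (\<forall>f\<in>poly_ring N. \<forall>w\<in>free_module N b. h (\<lambda>j. f * w j) = (\<lambda>j. f * h w j)) \<and>
     (\<forall>w\<in>free_module N b. \<forall>a. homogeneous_vec b e a w \<longrightarrow> homogeneous_vec b' e' a (h w))"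

text \<open>
  \<open>0 \<rightarrow> F\<^sub>p \<rightarrow> \<dots> \<rightarrow> F\<^sub>1 \<rightarrow> R \<rightarrow> R/I \<rightarrow> 0\<close> is a minimal graded free resolution of \<open>R/I\<close>, where
  \<open>F\<^sub>i = R(-e i 1) \<oplus> \<dots> \<oplus> R(-e i (\<beta> i))\<close>, \<open>d i : F\<^sub>i \<rightarrow> F\<^bsub>i - 1\<^esub>\<close>, \<open>F\<^sub>0 = R\<close>, and \<open>R \<rightarrow> R/I\<close> is the
  projection, so that exactness at \<open>R\<close> says that the image of \<open>d 1\<close> is \<open>I\<close>. The complex is continued
  by \<open>F\<^sub>i = 0\<close> for \<open>i > p\<close>; thus exactness at \<open>F\<^sub>p\<close> is injectivity of \<open>d p\<close>. The last conjunct is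
  minimality: the image of \<open>d i\<close> lies in \<open>\<mm> F\<^bsub>i - 1\<^esub>\<close>, with \<open>\<mm>\<close> the irrelevant ideal.
\<close>
definition minimal_graded_free_resolution ::
  "nat \<Rightarrow> (nat, 'k::field) mpoly set \<Rightarrow> nat \<Rightarrow> (nat \<Rightarrow> nat) \<Rightarrow> (nat \<Rightarrow> nat \<Rightarrow> int) \<Rightarrow>
   (nat \<Rightarrow> (nat \<Rightarrow> (nat, 'k) mpoly) \<Rightarrow> (nat \<Rightarrow> (nat, 'k) mpoly)) \<Rightarrow> bool" where
  "minimal_graded_free_resolution N I p \<beta> e d \<longleftrightarrow>
     \<beta> 0 = 1 \<and> e 0 1 = 0 \<and> (\<forall>i>p. \<beta> i = 0) \<and>
     (\<forall>i\<ge>1. graded_hom N (\<beta> i) (e i) (\<beta> (i - 1)) (e (i - 1)) (d i)) \<and>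
     d 1 ` free_module N (\<beta> 1) = {w \<in> free_module N 1. w 1 \<in> I} \<and>
     (\<forall>i\<ge>1. d (i + 1) ` free_module N (\<beta> (i + 1)) =
             {w \<in> free_module N (\<beta> i). d i w = (\<lambda>j. 0)}) \<and>
     (\<forall>i\<ge>1. \<forall>w\<in>free_module N (\<beta> i). \<forall>j\<in>{1..\<beta> (i - 1)}. d i w j \<in> irrelevant_ideal N)"

text \<open>
  The Castelnuovo-Mumford regularity of \<open>R/I\<close>. The definite description is meaningful because a
  minimal graded free resolution exists and is unique up to isomorphism. As the maximum ranges over
  \<open>i \<ge> 1\<close>, the definition is intended for \<open>I \<noteq> 0\<close>.
\<close>
definition regularity_quotient :: "nat \<Rightarrow> (nat, 'k::field) mpoly set \<Rightarrow> int" where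
  "regularity_quotient N I =
     (THE r. \<exists>p \<beta> e d. minimal_graded_free_resolution N I p \<beta> e d \<and>
        r = Max {e i j - int i | i j. i \<in> {1..p} \<and> j \<in> {1..\<beta> i}})"

end

(*
  Take the variables in the order x_{n+1}, x_n, x_1, ..., x_{n-1}. The first two form a regular
  sequence on M = K[C], and M/(x_{n+1}, x_n)M is Artinian, with a top nonzero degree r that is read
  off from the semigroup of pairs (degree, weight) = (delta, k m_1 + q d), k <= delta, q <= k (n-1).
  A polynomial lies in I(C) + (x_v : v in X) iff its coefficients sum to zero over every fibre of
  (degree, weight) that contains no monomial divisible by a variable of X, which turns both facts
  into statements about this semigroup.

  For a graded module M, the long exact Tor sequence of multiplication by x on M/JM (J generated by
  variables) shows that, if x_1, ..., x_c is M-regular and each later variable is injective modulo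
  its predecessors in degrees above r, then the first syzygy module of M has the same property with
  c + 1 and r + 1. At the end of the chain J is the irrelevant ideal, where Tor_1 counts minimal
  generators. Hence the generators of F_i have degree at most r + i and F_i = 0 for large i, which
  also yields a minimal resolution of finite length; a single failure of injectivity in degree r
  propagates likewise to a generator of degree exactly r + i in the last module.
*)
theory Submission
  imports Defs "HOL-Library.Function_Algebras"
begin

text \<open>The definite description requires that some minimal resolution of finite length exists
  and that every one gives the same maximum. Hence the degree bounds are proved for an arbitrary
  minimal resolution, and the same chain of variables drives the construction of one.

  For F free, M = F/B and J an ideal of variables, Tor_1(M, R/J) is the quotient of the intersection
  of B and J F by J B. All homology thus becomes membership in submodules of free modules, one
  degree at a time. The lower bound forces this control of single degrees: a failure survives a
  syzygy step because Tor_1 vanishes one degree higher.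

  The constant r comes from d * m_1 = m_1 * d: in k m_1 + q d one may trade d units of k for m_1
  units of q, and coprimality makes every exchange a multiple of this one. For k = delta and q = n -
  2, the largest q for which x_n cannot be split off, the trade respects q <= k (n - 1) iff m_n + n
  - 2 <= delta (n - 1). The regularity is the last degree delta in which this fails.\<close>

subsection \<open>Polynomials\<close>

text \<open>A finite sum of terms, so that finite support is automatic; for the constantly true
  \<open>P\<close> it is the expansion of \<open>f\<close> into its terms.\<close>

definition pfilter :: "('a \<Rightarrow> bool) \<Rightarrow> ('a \<Rightarrow>\<^sub>0 'b::comm_monoid_add) \<Rightarrow> ('a \<Rightarrow>\<^sub>0 'b)" where
  "pfilter P f = (\<Sum>t\<in>{t \<in> Poly_Mapping.keys f. P t}. Poly_Mapping.single t (Poly_Mapping.lookup f t))"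

lemma lookup_pfilter:
  "Poly_Mapping.lookup (pfilter P f) t = (if P t then Poly_Mapping.lookup f t else 0)"
proof -
  have "Poly_Mapping.lookup (pfilter P f) t
      = (\<Sum>s\<in>{s \<in> Poly_Mapping.keys f. P s}. if s = t then Poly_Mapping.lookup f s else 0)"
    by (simp add: pfilter_def lookup_sum lookup_single when_def)
  also have "\<dots> = (if P t then Poly_Mapping.lookup f t else 0)"
    by (auto simp: in_keys_iff)
  finally show ?thesis .
qed

lemma keys_pfilter: "Poly_Mapping.keys (pfilter P f) = {t \<in> Poly_Mapping.keys f. P t}"
  by (auto simp: in_keys_iff lookup_pfilter split: if_splits)

lemma pfilter_split: "pfilter P f + pfilter (\<lambda>t. \<not> P t) f = f"
  by (rule poly_mapping_eqI) (simp add: lookup_add lookup_pfilter)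

lemma lookup_single_mult:
  fixes f :: "('v \<Rightarrow>\<^sub>0 nat) \<Rightarrow>\<^sub>0 'k::comm_ring_1"
  shows "Poly_Mapping.lookup (Poly_Mapping.single s c * f) (s + t) = c * Poly_Mapping.lookup f t"
proof -
  have "Poly_Mapping.lookup (Poly_Mapping.single s c * f) (s + t)
      = Sum_any (\<lambda>l. (c when s = l) * Sum_any (\<lambda>q. Poly_Mapping.lookup f q when s + t = l + q))"
    by (simp add: lookup_mult lookup_single)
  also have "\<dots> = Sum_any (\<lambda>l. (c * Sum_any (\<lambda>q. Poly_Mapping.lookup f q when s + t = l + q)) when s = l)"
    by (rule Sum_any.cong) (simp add: when_def)
  also have "\<dots> = c * Sum_any (\<lambda>q. Poly_Mapping.lookup f q when t = q)"
    by simp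
  finally show ?thesis by simp
qed

lemma keys_single_mult:
  fixes f :: "('v \<Rightarrow>\<^sub>0 nat) \<Rightarrow>\<^sub>0 'k::comm_ring_1"
  shows "Poly_Mapping.keys (Poly_Mapping.single s c * f) \<subseteq> (+) s ` Poly_Mapping.keys f"
  using keys_mult[of "Poly_Mapping.single s c" f] by (auto split: if_splits)

lemma lookup_mvar_mult:
  fixes f :: "('v, 'k::comm_ring_1) mpoly"
  shows "Poly_Mapping.lookup (mvar v * f) (Poly_Mapping.single v 1 + t) = Poly_Mapping.lookup f t"
  by (simp only: mvar_def lookup_single_mult mult_1)

text \<open>An equality, where products in general give only an inclusion: multiplication by a
  variable shifts the monomials injectively, so nothing cancels. The later cancellation of variables
  rests on this.\<close>

lemma keys_mvar_mult:
  fixes f :: "('v, 'k::comm_ring_1) mpoly"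
  shows "Poly_Mapping.keys (mvar v * f) = (+) (Poly_Mapping.single v 1) ` Poly_Mapping.keys f"
proof
  show "Poly_Mapping.keys (mvar v * f) \<subseteq> (+) (Poly_Mapping.single v 1) ` Poly_Mapping.keys f"
    unfolding mvar_def by (rule keys_single_mult)
  show "(+) (Poly_Mapping.single v 1) ` Poly_Mapping.keys f \<subseteq> Poly_Mapping.keys (mvar v * f)"
    by (auto simp only: in_keys_iff lookup_mvar_mult image_subset_iff)
qed

lemma single_1_add_diff:
  assumes "Poly_Mapping.lookup t v \<noteq> (0::nat)"
  shows "Poly_Mapping.single v 1 + (t - Poly_Mapping.single v 1) = t"
  using assms by (intro poly_mapping_eqI) (auto simp: lookup_add lookup_minus lookup_single when_def minus_poly_mapping.rep_eq)

section \<open>Total degree of monomials\<close>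

lemma mon_degree_eq_sum:
  assumes "finite A" "Poly_Mapping.keys t \<subseteq> A"
  shows "mon_degree t = (\<Sum>i\<in>A. Poly_Mapping.lookup t i)"
  unfolding mon_degree_def using assms
  by (intro sum.mono_neutral_left) (auto simp: in_keys_iff)

lemma mon_degree_add: "mon_degree (s + t) = mon_degree s + mon_degree t"
proof -
  let ?A = "Poly_Mapping.keys s \<union> Poly_Mapping.keys t"
  have "mon_degree (s + t) = (\<Sum>i\<in>?A. Poly_Mapping.lookup (s + t) i)"
    by (rule mon_degree_eq_sum) (use keys_add[of s t] in auto)
  then show ?thesis
    by (simp add: lookup_add sum.distrib mon_degree_eq_sum[of ?A])
qed

lemma mon_degree_0 [simp]: "mon_degree 0 = 0"
  by (simp add: mon_degree_def)

lemma mon_degree_eq_0_iff: "mon_degree t = 0 \<longleftrightarrow> t = 0"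
proof
  assume "mon_degree t = 0"
  then show "t = 0"
    by (intro poly_mapping_eqI) (auto simp: mon_degree_def in_keys_iff)
qed simp

lemma mon_degree_single [simp]: "mon_degree (Poly_Mapping.single v k) = k"
  by (simp add: mon_degree_def)

lemma keys_add_nat:
  "Poly_Mapping.keys (s + t) = Poly_Mapping.keys s \<union> Poly_Mapping.keys (t :: 'a \<Rightarrow>\<^sub>0 nat)"
  by (auto simp: in_keys_iff lookup_add)

section \<open>The subring of polynomials in N variables\<close>

lemma poly_ring_0 [simp]: "0 \<in> poly_ring N"
  and poly_ring_1 [simp]: "1 \<in> poly_ring N"
  by (auto simp: poly_ring_def)

lemma poly_ring_mconst [simp]: "mconst c \<in> poly_ring N"
  by (auto simp: poly_ring_def mconst_def)

lemma poly_ring_mvar: "v \<in> {1..N} \<Longrightarrow> mvar v \<in> poly_ring N"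
  by (auto simp: poly_ring_def mvar_def)

lemma poly_ring_add: "f \<in> poly_ring N \<Longrightarrow> g \<in> poly_ring N \<Longrightarrow> f + g \<in> poly_ring N"
  using keys_add[of f g] by (fastforce simp: poly_ring_def)

lemma poly_ring_mult: "f \<in> poly_ring N \<Longrightarrow> g \<in> poly_ring N \<Longrightarrow> f * g \<in> poly_ring N"
  using keys_mult[of f g] by (fastforce simp: poly_ring_def keys_add_nat)

lemma poly_ring_uminus: "f \<in> poly_ring N \<Longrightarrow> - f \<in> poly_ring N"
  by (auto simp: poly_ring_def in_keys_iff)

lemma poly_ring_diff: "f \<in> poly_ring N \<Longrightarrow> g \<in> poly_ring N \<Longrightarrow> f - g \<in> poly_ring N"
  using poly_ring_add[OF _ poly_ring_uminus] by fastforce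

lemma poly_ring_sum: "(\<And>i. i \<in> A \<Longrightarrow> f i \<in> poly_ring N) \<Longrightarrow> sum f A \<in> poly_ring N"
  by (induction A rule: infinite_finite_induct) (auto simp: poly_ring_add)

lemma poly_ring_pfilter: "f \<in> poly_ring N \<Longrightarrow> pfilter P f \<in> poly_ring N"
  by (auto simp: poly_ring_def keys_pfilter)

lemma poly_ring_mvar_mult_cancel:
  assumes "mvar v * f \<in> poly_ring N"
  shows "f \<in> poly_ring N"
  using assms by (auto simp: poly_ring_def keys_mvar_mult keys_add_nat)

section \<open>Homogeneous polynomials and homogeneous components\<close>

lemma homogeneous_0 [simp]: "homogeneous a 0"
  by (simp add: homogeneous_def)

lemma homogeneous_add: "homogeneous a f \<Longrightarrow> homogeneous a g \<Longrightarrow> homogeneous a (f + g)"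
  using keys_add[of f g] by (fastforce simp: homogeneous_def)

lemma homogeneous_uminus: "homogeneous a f \<Longrightarrow> homogeneous a (- f)"
  by (auto simp: homogeneous_def in_keys_iff)

lemma homogeneous_diff: "homogeneous a f \<Longrightarrow> homogeneous a g \<Longrightarrow> homogeneous a (f - g)"
  using homogeneous_add[OF _ homogeneous_uminus] by fastforce

lemma homogeneous_mult:
  "homogeneous a f \<Longrightarrow> homogeneous b g \<Longrightarrow> homogeneous (a + b) (f * g)"
  using keys_mult[of f g] by (fastforce simp: homogeneous_def mon_degree_add)

lemma homogeneous_mvar_mult_iff:
  "homogeneous (a + 1) (mvar v * f) \<longleftrightarrow> homogeneous a f"
  by (simp add: homogeneous_def keys_mvar_mult mon_degree_add)

lemma homogeneous_1 [simp]: "homogeneous 0 1"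
  by (simp add: homogeneous_def)

lemma homogeneous_mvar [simp]: "homogeneous 1 (mvar v)"
  by (simp add: homogeneous_def mvar_def)

definition hcomp :: "int \<Rightarrow> ('v, 'k::comm_ring_1) mpoly \<Rightarrow> ('v, 'k) mpoly" where
  "hcomp a = pfilter (\<lambda>t. int (mon_degree t) = a)"

lemma homogeneous_hcomp [simp]: "homogeneous a (hcomp a f)"
  by (auto simp: homogeneous_def hcomp_def keys_pfilter)

lemma hcomp_id: "homogeneous a f \<Longrightarrow> hcomp a f = f"
  by (rule poly_mapping_eqI) (auto simp: homogeneous_def hcomp_def lookup_pfilter in_keys_iff)

lemma hcomp_other: "homogeneous b f \<Longrightarrow> a \<noteq> b \<Longrightarrow> hcomp a f = 0"
  by (rule poly_mapping_eqI) (auto simp: homogeneous_def hcomp_def lookup_pfilter in_keys_iff)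

lemma poly_ring_hcomp: "f \<in> poly_ring N \<Longrightarrow> hcomp a f \<in> poly_ring N"
  by (simp add: hcomp_def poly_ring_pfilter)

lemma hcomp_0 [simp]: "hcomp a 0 = 0"
  by (simp add: hcomp_id)

lemma hcomp_add: "hcomp a (f + g) = hcomp a f + hcomp a g"
  by (rule poly_mapping_eqI) (simp add: hcomp_def lookup_pfilter lookup_add)

lemma hcomp_diff: "hcomp a (f - g) = hcomp a f - hcomp a g"
  by (rule poly_mapping_eqI) (simp add: hcomp_def lookup_pfilter lookup_minus)

lemma hcomp_sum: "hcomp a (sum f A) = (\<Sum>i\<in>A. hcomp a (f i))"
  by (induction A rule: infinite_finite_induct) (auto simp: hcomp_add)

lemma hcomp_mvar_mult: "hcomp (a + 1) (mvar v * f) = mvar v * hcomp a f"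
proof (rule poly_mapping_eqI)
  fix t
  show "Poly_Mapping.lookup (hcomp (a + 1) (mvar v * f)) t = Poly_Mapping.lookup (mvar v * hcomp a f) t"
  proof (cases "t \<in> range ((+) (Poly_Mapping.single v 1))")
    case True
    then obtain s where s: "t = Poly_Mapping.single v 1 + s" by auto
    show ?thesis
      unfolding s hcomp_def lookup_pfilter lookup_mvar_mult by (simp add: mon_degree_add)
  next
    case False
    then have "t \<notin> Poly_Mapping.keys (mvar v * f)" "t \<notin> Poly_Mapping.keys (mvar v * hcomp a f)"
      by (auto simp: keys_mvar_mult)
    then show ?thesis
      by (simp add: hcomp_def lookup_pfilter in_keys_iff)
  qed
qed

lemma sum_hcomp:
  assumes "finite A" "\<And>t. t \<in> Poly_Mapping.keys f \<Longrightarrow> int (mon_degree t) \<in> A"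
  shows "(\<Sum>a\<in>A. hcomp a f) = f"
proof (rule poly_mapping_eqI)
  fix t
  have "Poly_Mapping.lookup (\<Sum>a\<in>A. hcomp a f) t
      = (\<Sum>a\<in>A. if int (mon_degree t) = a then Poly_Mapping.lookup f t else 0)"
    by (simp add: lookup_sum hcomp_def lookup_pfilter)
  also have "\<dots> = Poly_Mapping.lookup f t"
    using assms by (auto simp: in_keys_iff)
  finally show "Poly_Mapping.lookup (\<Sum>a\<in>A. hcomp a f) t = Poly_Mapping.lookup f t" .
qed

text \<open>The ideal generated by the variables in \<open>X\<close>, described by its monomials.\<close>
definition var_ideal :: "'v set \<Rightarrow> ('v, 'k::comm_ring_1) mpoly set" where
  "var_ideal X = {f. \<forall>t\<in>Poly_Mapping.keys f. \<exists>v\<in>X. Poly_Mapping.lookup t v \<noteq> 0}"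

lemma var_ideal_0 [simp]: "0 \<in> var_ideal X"
  by (simp add: var_ideal_def)

lemma var_ideal_add: "f \<in> var_ideal X \<Longrightarrow> g \<in> var_ideal X \<Longrightarrow> f + g \<in> var_ideal X"
  using keys_add[of f g] by (fastforce simp: var_ideal_def)

lemma var_ideal_uminus: "f \<in> var_ideal X \<Longrightarrow> - f \<in> var_ideal X"
  by (auto simp: var_ideal_def in_keys_iff)

lemma var_ideal_diff: "f \<in> var_ideal X \<Longrightarrow> g \<in> var_ideal X \<Longrightarrow> f - g \<in> var_ideal X"
  using var_ideal_add[OF _ var_ideal_uminus] by fastforce

lemma var_ideal_sum: "(\<And>i. i \<in> A \<Longrightarrow> f i \<in> var_ideal X) \<Longrightarrow> sum f A \<in> var_ideal X"
  by (induction A rule: infinite_finite_induct) (auto simp: var_ideal_add)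

lemma var_ideal_mult: "f \<in> var_ideal X \<Longrightarrow> g * f \<in> var_ideal X"
  unfolding var_ideal_def
proof safe
  fix t
  assume f: "\<forall>t\<in>Poly_Mapping.keys f. \<exists>v\<in>X. Poly_Mapping.lookup t v \<noteq> 0"
    and "t \<in> Poly_Mapping.keys (g * f)"
  then obtain s u where "t = s + u" "u \<in> Poly_Mapping.keys f" using keys_mult[of g f] by auto
  then show "\<exists>v\<in>X. Poly_Mapping.lookup t v \<noteq> 0" using f by (auto simp: lookup_add)
qed

lemma var_ideal_mvar: "v \<in> X \<Longrightarrow> mvar v * f \<in> var_ideal X"
  by (force simp: var_ideal_def keys_mvar_mult lookup_add)

lemma var_ideal_mono: "X \<subseteq> Y \<Longrightarrow> var_ideal X \<subseteq> var_ideal Y"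
  by (fastforce simp: var_ideal_def)

lemma var_ideal_empty [simp]: "var_ideal {} = {0}"
  by (auto simp: var_ideal_def keys_eq_empty[symmetric] simp del: keys_eq_empty)

text \<open>A variable outside \<open>X\<close> is a nonzerodivisor modulo the ideal, because
  multiplying a monomial by it does not change the exponents at \<open>X\<close>.\<close>

lemma var_ideal_cancel_mvar: "mvar v * f \<in> var_ideal X \<Longrightarrow> v \<notin> X \<Longrightarrow> f \<in> var_ideal X"
  by (fastforce simp: var_ideal_def keys_mvar_mult lookup_add lookup_single when_def split: if_splits)

lemma var_ideal_pfilter: "f \<in> var_ideal X \<Longrightarrow> pfilter P f \<in> var_ideal X"
  by (auto simp: var_ideal_def keys_pfilter)

lemma divide_mvar:
  fixes f :: "('v, 'k::comm_ring_1) mpoly"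
  assumes "f \<in> var_ideal {v}"
  shows "\<exists>g. f = mvar v * g"
proof -
  define g where "g = (\<Sum>t\<in>Poly_Mapping.keys f.
     Poly_Mapping.single (t - Poly_Mapping.single v 1) (Poly_Mapping.lookup f t))"
  have "mvar v * g = (\<Sum>t\<in>Poly_Mapping.keys f. Poly_Mapping.single t (Poly_Mapping.lookup f t))"
    unfolding g_def sum_distrib_left mvar_def
  proof (rule sum.cong[OF refl])
    fix t assume "t \<in> Poly_Mapping.keys f"
    then have "Poly_Mapping.lookup t v \<noteq> 0" using assms by (auto simp: var_ideal_def)
    then show "Poly_Mapping.single (Poly_Mapping.single v 1) 1 *
        Poly_Mapping.single (t - Poly_Mapping.single v 1) (Poly_Mapping.lookup f t) =
        Poly_Mapping.single t (Poly_Mapping.lookup f t)"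
      by (simp only: mult_single single_1_add_diff[of t v] mult_1 not_False_eq_True)
  qed
  also have "\<dots> = pfilter (\<lambda>_. True) f" by (simp add: pfilter_def)
  also have "\<dots> = f" by (rule poly_mapping_eqI) (simp add: lookup_pfilter)
  finally have "mvar v * g = f" .
  then show ?thesis by (intro exI[of _ g]) simp
qed

text \<open>The terms of \<open>f\<close> without a variable from \<open>X\<close> must be divisible
  by \<open>x_v\<close>; their quotient is \<open>g\<close>. One \<open>g\<close> meets all side
  conditions, since selecting terms and dividing by a variable respect degree and ring.\<close>

lemma var_ideal_insert_split:
  fixes f :: "(nat, 'k::comm_ring_1) mpoly"
  assumes "f \<in> var_ideal (insert v X)"
  shows "\<exists>g. f - mvar v * g \<in> var_ideal X \<and> (\<forall>a. homogeneous (a + 1) f \<longrightarrow> homogeneous a g)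
    \<and> (f \<in> poly_ring N \<longrightarrow> g \<in> poly_ring N)"
proof -
  let ?P = "\<lambda>t. \<exists>v\<in>X. Poly_Mapping.lookup t v \<noteq> 0"
  define f1 where "f1 = pfilter (\<lambda>t. \<not> ?P t) f"
  have "f1 \<in> var_ideal {v}"
    unfolding var_ideal_def
  proof safe
    fix t assume "t \<in> Poly_Mapping.keys f1"
    then have "t \<in> Poly_Mapping.keys f" "\<not> ?P t" by (simp_all add: f1_def keys_pfilter)
    moreover from this(1) have "\<exists>u\<in>insert v X. Poly_Mapping.lookup t u \<noteq> 0"
      using assms unfolding var_ideal_def by blast
    ultimately show "\<exists>u\<in>{v}. Poly_Mapping.lookup t u \<noteq> 0" by blast
  qed
  then obtain g where g: "f1 = mvar v * g" using divide_mvar[of f1 v] by auto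
  have eq: "pfilter ?P f = f - f1"
    unfolding eq_diff_eq f1_def by (rule pfilter_split)
  have "f - mvar v * g \<in> var_ideal X"
    unfolding g[symmetric] eq[symmetric] by (simp add: var_ideal_def keys_pfilter)
  moreover have "homogeneous a g" if "homogeneous (a + 1) f" for a
  proof -
    have "homogeneous (a + 1) f1"
      using that by (auto simp: homogeneous_def keys_pfilter f1_def)
    then show ?thesis by (simp add: homogeneous_mvar_mult_iff g)
  qed
  moreover have "g \<in> poly_ring N" if "f \<in> poly_ring N"
    using poly_ring_mvar_mult_cancel[of v g N] poly_ring_pfilter[OF that, of "\<lambda>t. \<not> ?P t"]
    unfolding f1_def[symmetric] g by blast
  ultimately show ?thesis by blast
qed

text \<open>Turns the constant-term condition into divisibility by variables, so that minimality of
  a resolution speaks of the last ideal in the chain of variables.\<close>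

lemma irrelevant_ideal_eq: "irrelevant_ideal N = poly_ring N \<inter> var_ideal {1..N}"
proof -
  have *: "t \<noteq> 0 \<longleftrightarrow> (\<exists>v\<in>{1..N}. Poly_Mapping.lookup t v \<noteq> 0)"
    if "Poly_Mapping.keys t \<subseteq> {1..N}" for t :: "nat \<Rightarrow>\<^sub>0 nat"
  proof
    assume "t \<noteq> 0"
    then obtain v where "v \<in> Poly_Mapping.keys t" by (metis keys_eq_empty all_not_in_conv)
    then show "\<exists>v\<in>{1..N}. Poly_Mapping.lookup t v \<noteq> 0" using that by (metis in_keys_iff subsetD)
  qed auto
  have "Poly_Mapping.lookup f 0 = 0 \<longleftrightarrow> f \<in> var_ideal {1..N}" if f: "f \<in> poly_ring N"
    for f :: "(nat, 'a) mpoly"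
  proof -
    have "Poly_Mapping.lookup f 0 = 0 \<longleftrightarrow> (\<forall>t\<in>Poly_Mapping.keys f. t \<noteq> 0)"
      by (metis in_keys_iff)
    also have "\<dots> \<longleftrightarrow> f \<in> var_ideal {1..N}"
      using f * by (simp add: var_ideal_def poly_ring_def)
    finally show ?thesis .
  qed
  then show ?thesis by (auto simp: irrelevant_ideal_def)
qed

subsection \<open>Graded submodules of free modules\<close>

text \<open>A named scalar multiplication lets vectors be handled with the pointwise group structure
  of \<open>Function_Algebras\<close> instead of the lambda terms in
  \<open>graded_hom\<close>.\<close>

definition smul :: "'a::times \<Rightarrow> ('i \<Rightarrow> 'a) \<Rightarrow> 'i \<Rightarrow> 'a" where
  "smul f w = (\<lambda>j. f * w j)"

lemma smul_apply [simp]: "smul f w j = f * w j"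
  by (simp add: smul_def)

lemma sum_fun_apply: "sum f A x = (\<Sum>i\<in>A. f i x)"
  by (induction A rule: infinite_finite_induct) auto

lemma smul_add: "smul f (w + w' :: 'i \<Rightarrow> 'a::ring) = smul f w + smul f w'"
  by (simp add: fun_eq_iff algebra_simps)

lemma smul_diff: "smul f (w - w' :: 'i \<Rightarrow> 'a::ring) = smul f w - smul f w'"
  by (simp add: fun_eq_iff algebra_simps)

lemma smul_0 [simp]: "smul f 0 = (0 :: 'i \<Rightarrow> 'a::ring)"
  by (simp add: fun_eq_iff)

lemma smul_sum: "smul f (sum w A :: 'i \<Rightarrow> 'a::ring) = (\<Sum>i\<in>A. smul f (w i))"
  by (rule ext) (simp add: sum_fun_apply sum_distrib_left)

lemma free_module_apply: "w \<in> free_module N b \<Longrightarrow> w j \<in> poly_ring N"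
  by (cases "j \<in> {1..b}") (auto simp: free_module_def)

lemma free_module_0 [simp]: "0 \<in> free_module N b"
  by (auto simp: free_module_def)

lemma free_module_add: "w \<in> free_module N b \<Longrightarrow> w' \<in> free_module N b \<Longrightarrow> w + w' \<in> free_module N b"
  by (auto simp: free_module_def poly_ring_add)

lemma free_module_diff: "w \<in> free_module N b \<Longrightarrow> w' \<in> free_module N b \<Longrightarrow> w - w' \<in> free_module N b"
  by (auto simp: free_module_def poly_ring_diff)

lemma free_module_smul: "w \<in> free_module N b \<Longrightarrow> f \<in> poly_ring N \<Longrightarrow> smul f w \<in> free_module N b"
  by (auto simp: free_module_def poly_ring_mult)

lemma homogeneous_vec_0 [simp]: "homogeneous_vec b e a 0"
  by (simp add: homogeneous_vec_def)

lemma homogeneous_vec_add: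
  "homogeneous_vec b e a w \<Longrightarrow> homogeneous_vec b e a w' \<Longrightarrow> homogeneous_vec b e a (w + w')"
  by (simp add: homogeneous_vec_def homogeneous_add)

lemma homogeneous_vec_diff:
  "homogeneous_vec b e a w \<Longrightarrow> homogeneous_vec b e a w' \<Longrightarrow> homogeneous_vec b e a (w - w')"
  by (simp add: homogeneous_vec_def homogeneous_diff)

lemma homogeneous_vec_sum:
  "(\<And>i. i \<in> A \<Longrightarrow> homogeneous_vec b e a (w i)) \<Longrightarrow> homogeneous_vec b e a (sum w A)"
  by (induction A rule: infinite_finite_induct) (auto simp: homogeneous_vec_add)

lemma homogeneous_vec_smul:
  "homogeneous c f \<Longrightarrow> homogeneous_vec b e a w \<Longrightarrow> homogeneous_vec b e (c + a) (smul f w)"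
  using homogeneous_mult by (fastforce simp: homogeneous_vec_def add_diff_eq[symmetric])

lemma homogeneous_vec_mvar:
  "homogeneous_vec b e a w \<Longrightarrow> homogeneous_vec b e (a + 1) (smul (mvar v) w)"
  using homogeneous_vec_smul[OF homogeneous_mvar, of b e a w v] by (simp add: add.commute)

section \<open>Homogeneous components of vectors\<close>

definition hcomp_vec ::
  "(nat \<Rightarrow> int) \<Rightarrow> int \<Rightarrow> (nat \<Rightarrow> (nat, 'k::comm_ring_1) mpoly) \<Rightarrow> nat \<Rightarrow> (nat, 'k) mpoly" where
  "hcomp_vec e a w = (\<lambda>j. hcomp (a - e j) (w j))"

lemma hcomp_vec_apply: "hcomp_vec e a w j = hcomp (a - e j) (w j)"
  by (simp add: hcomp_vec_def)

lemma homogeneous_hcomp_vec [simp]: "homogeneous_vec b e a (hcomp_vec e a w)"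
  by (simp add: homogeneous_vec_def hcomp_vec_def)

lemma hcomp_vec_id:
  "w \<in> free_module N b \<Longrightarrow> homogeneous_vec b e a w \<Longrightarrow> hcomp_vec e a w = w"
  by (rule ext, case_tac "x \<in> {1..b}")
    (auto simp: hcomp_vec_def homogeneous_vec_def free_module_def hcomp_id)

lemma hcomp_vec_other:
  "w \<in> free_module N b \<Longrightarrow> homogeneous_vec b e c w \<Longrightarrow> a \<noteq> c \<Longrightarrow> hcomp_vec e a w = 0"
  by (rule ext, case_tac "x \<in> {1..b}")
    (auto simp: hcomp_vec_def homogeneous_vec_def free_module_def intro!: hcomp_other)

lemma hcomp_vec_0 [simp]: "hcomp_vec e a 0 = 0"
  by (simp add: hcomp_vec_def fun_eq_iff)

lemma hcomp_vec_diff: "hcomp_vec e a (w - w') = hcomp_vec e a w - hcomp_vec e a w'"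
  by (simp add: hcomp_vec_def fun_eq_iff hcomp_diff)

lemma hcomp_vec_sum: "hcomp_vec e a (sum w A) = (\<Sum>i\<in>A. hcomp_vec e a (w i))"
  by (rule ext) (simp add: sum_fun_apply hcomp_vec_def hcomp_sum)

lemma hcomp_vec_mvar: "hcomp_vec e (a + 1) (smul (mvar v) w) = smul (mvar v) (hcomp_vec e a w)"
proof
  fix j
  have "a + 1 - e j = a - e j + 1" by simp
  then show "hcomp_vec e (a + 1) (smul (mvar v) w) j = smul (mvar v) (hcomp_vec e a w) j"
    by (simp only: hcomp_vec_def smul_apply hcomp_mvar_mult)
qed

lemma hcomp_vec_free_module: "w \<in> free_module N b \<Longrightarrow> hcomp_vec e a w \<in> free_module N b"
  by (auto simp: free_module_def hcomp_vec_def poly_ring_hcomp)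

text \<open>The claim covers all larger index sets, so that a prescribed degree can be added to the
  sum.\<close>

lemma sum_hcomp_vec:
  assumes "w \<in> free_module N b"
  shows "\<exists>A. finite A \<and> (\<forall>A'. finite A' \<longrightarrow> A \<subseteq> A' \<longrightarrow> (\<Sum>a\<in>A'. hcomp_vec e a w) = w)"
proof (intro exI conjI allI impI)
  let ?A = "\<Union>j\<in>{1..b}. (\<lambda>t. int (mon_degree t) + e j) ` Poly_Mapping.keys (w j)"
  show "finite ?A" by auto
  fix A' assume A': "finite A'" "?A \<subseteq> A'"
  show "(\<Sum>a\<in>A'. hcomp_vec e a w) = w"
  proof
    fix j
    have "(\<Sum>a\<in>A'. hcomp_vec e a w) j = (\<Sum>c\<in>(\<lambda>a. a - e j) ` A'. hcomp c (w j))"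
      by (simp add: sum_fun_apply hcomp_vec_def sum.reindex inj_on_def)
    also have "\<dots> = w j"
    proof (cases "j \<in> {1..b}")
      case True
      show ?thesis
      proof (rule sum_hcomp)
        fix t assume "t \<in> Poly_Mapping.keys (w j)"
        then have "int (mon_degree t) + e j \<in> A'" using True A' by blast
        then show "int (mon_degree t) \<in> (\<lambda>a. a - e j) ` A'" by force
      qed (use A' in auto)
    next
      case False
      then have "w j = 0" using assms by (auto simp: free_module_def)
      then show ?thesis by simp
    qed
    finally show "(\<Sum>a\<in>A'. hcomp_vec e a w) j = w j" .
  qed
qed

section \<open>The submodules J F and J B for an ideal J of variables\<close>

text \<open>Intersected with a free module F this is J F. Vectors are extended by zero, so one set
  serves the free modules of all ranks.\<close>

definition var_submodule :: "nat set \<Rightarrow> (nat \<Rightarrow> (nat, 'k::comm_ring_1) mpoly) set" where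
  "var_submodule X = {w. \<forall>j. w j \<in> var_ideal X}"

lemma var_submodule_0 [simp]: "0 \<in> var_submodule X"
  by (simp add: var_submodule_def)

lemma var_submodule_add: "w \<in> var_submodule X \<Longrightarrow> w' \<in> var_submodule X \<Longrightarrow> w + w' \<in> var_submodule X"
  by (simp add: var_submodule_def var_ideal_add)

lemma var_submodule_diff: "w \<in> var_submodule X \<Longrightarrow> w' \<in> var_submodule X \<Longrightarrow> w - w' \<in> var_submodule X"
  by (simp add: var_submodule_def var_ideal_diff)

lemma var_submodule_smul: "w \<in> var_submodule X \<Longrightarrow> smul f w \<in> var_submodule X"
  by (simp add: var_submodule_def var_ideal_mult)

lemma var_submodule_mvar: "v \<in> X \<Longrightarrow> smul (mvar v) w \<in> var_submodule X"
  by (simp add: var_submodule_def var_ideal_mvar)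

lemma var_submodule_mono: "X \<subseteq> Y \<Longrightarrow> var_submodule X \<subseteq> var_submodule Y"
  using var_ideal_mono by (fastforce simp: var_submodule_def)

lemma var_submodule_empty: "var_submodule {} = {0}"
  by (auto simp: var_submodule_def fun_eq_iff)

lemma var_submodule_cancel_mvar:
  "smul (mvar v) w \<in> var_submodule X \<Longrightarrow> v \<notin> X \<Longrightarrow> w \<in> var_submodule X"
  using var_ideal_cancel_mvar by (fastforce simp: var_submodule_def)

lemma var_submodule_sum: "(\<And>i. i \<in> A \<Longrightarrow> w i \<in> var_submodule X) \<Longrightarrow> sum w A \<in> var_submodule X"
  by (induction A rule: infinite_finite_induct) (auto simp: var_submodule_add)

lemma var_submodule_insert_split:
  assumes w: "w \<in> var_submodule (insert v X)" "w \<in> free_module N b"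
  shows "\<exists>g \<in> free_module N b. w - smul (mvar v) g \<in> var_submodule X
    \<and> (\<forall>a. homogeneous_vec b e (a + 1) w \<longrightarrow> homogeneous_vec b e a g)"
proof -
  let ?P = "\<lambda>j g. w j - mvar v * g \<in> var_ideal X
     \<and> (\<forall>a. homogeneous (a + 1) (w j) \<longrightarrow> homogeneous a g) \<and> (w j \<in> poly_ring N \<longrightarrow> g \<in> poly_ring N)"
  have "\<forall>j. \<exists>g. ?P j g"
    using w(1) var_ideal_insert_split unfolding var_submodule_def by blast
  then obtain g where g: "\<And>j. ?P j (g j)" by metis
  define g' where "g' j = (if j \<in> {1..b} then g j else 0)" for j
  have "homogeneous_vec b e a g'" if "homogeneous_vec b e (a + 1) w" for a
    unfolding homogeneous_vec_def
  proof
    fix j assume j: "j \<in> {1..b}"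
    then have "homogeneous (a + 1 - e j) (w j)" using that by (auto simp: homogeneous_vec_def)
    then have "homogeneous (a - e j + 1) (w j)" by (simp add: algebra_simps)
    then show "homogeneous (a - e j) (g' j)" using g j by (simp add: g'_def)
  qed
  moreover have "w - smul (mvar v) g' \<in> var_submodule X"
    using g w(2) by (auto simp: var_submodule_def g'_def free_module_def)
  moreover have "g' \<in> free_module N b" using g w(2) by (auto simp: g'_def free_module_def)
  ultimately show ?thesis by blast
qed

text \<open>The submodule J B. What lies in B and in \<open>var_submodule X\<close> but not here is
  what Tor_1 measures.\<close>

definition var_mult ::
  "nat set \<Rightarrow> (nat \<Rightarrow> (nat, 'k::comm_ring_1) mpoly) set \<Rightarrow> (nat \<Rightarrow> (nat, 'k) mpoly) set" where
  "var_mult X B = {z. \<exists>g. (\<forall>v\<in>X. g v \<in> B) \<and> z = (\<Sum>v\<in>X. smul (mvar v) (g v))}"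

lemma var_mult_subset: "var_mult X B \<subseteq> var_submodule X"
  by (auto simp: var_mult_def intro!: var_submodule_sum var_submodule_mvar)

lemma var_mult_insertI:
  assumes "finite X" "v \<notin> X" "w \<in> var_mult X B" "y \<in> B"
  shows "w + smul (mvar v) y \<in> var_mult (insert v X) B"
proof -
  obtain g where g: "\<forall>v\<in>X. g v \<in> B" "w = (\<Sum>v\<in>X. smul (mvar v) (g v))"
    using assms(3) by (auto simp: var_mult_def)
  have "w + smul (mvar v) y = (\<Sum>u\<in>insert v X. smul (mvar u) ((g(v := y)) u))"
    using assms g by (auto simp: add.commute intro!: sum.cong)
  moreover have "\<forall>u\<in>insert v X. (g(v := y)) u \<in> B" using g assms by auto
  ultimately show ?thesis unfolding var_mult_def by blast
qed

lemma var_mult_insertE: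
  assumes "finite X" "v \<notin> X" "z \<in> var_mult (insert v X) B"
  obtains w y where "w \<in> var_mult X B" "y \<in> B" "z = w + smul (mvar v) y"
proof -
  obtain g where g: "\<forall>u\<in>insert v X. g u \<in> B" "z = (\<Sum>u\<in>insert v X. smul (mvar u) (g u))"
    using assms(3) by (auto simp: var_mult_def)
  show thesis
    by (rule that[of "\<Sum>u\<in>X. smul (mvar u) (g u)" "g v"])
      (use g assms in \<open>auto simp: var_mult_def add.commute\<close>)
qed

text \<open>For B = F the two descriptions of J F agree. A linear map can then be applied summand by
  summand to a vector that is known to lie in J F only coordinatewise.\<close>

lemma var_submodule_eq_var_mult:
  assumes "finite X" "w \<in> free_module N b" "w \<in> var_submodule X" "X \<subseteq> {1..N}"
  shows "w \<in> var_mult X (free_module N b)"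
  using assms
proof (induction X arbitrary: w rule: finite_induct)
  case empty
  then have "w = (\<Sum>v\<in>{}. smul (mvar v) 0)" by (simp only: var_submodule_empty sum.empty) simp
  then show ?case unfolding var_mult_def by (intro CollectI exI[of _ "\<lambda>_. 0"]) (simp add: zero_fun_def)
next
  case (insert v X)
  then obtain g where g: "g \<in> free_module N b" "w - smul (mvar v) g \<in> var_submodule X"
    using var_submodule_insert_split by metis
  have "w - smul (mvar v) g \<in> free_module N b"
    using insert.prems g by (intro free_module_diff free_module_smul poly_ring_mvar) auto
  then have "w - smul (mvar v) g \<in> var_mult X (free_module N b)"
    using insert g by auto
  from var_mult_insertI[OF insert.hyps(1,2) this g(1)] show ?case by simp
qed

section \<open>Graded submodules\<close>

definition graded_submodule ::
  "nat \<Rightarrow> nat \<Rightarrow> (nat \<Rightarrow> int) \<Rightarrow> (nat \<Rightarrow> (nat, 'k::comm_ring_1) mpoly) set \<Rightarrow> bool" where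
  "graded_submodule N b e B \<longleftrightarrow> B \<subseteq> free_module N b \<and> 0 \<in> B \<and>
     (\<forall>w\<in>B. \<forall>w'\<in>B. w + w' \<in> B) \<and> (\<forall>f\<in>poly_ring N. \<forall>w\<in>B. smul f w \<in> B) \<and>
     (\<forall>a. \<forall>w\<in>B. hcomp_vec e a w \<in> B)"

lemma graded_submoduleD:
  assumes "graded_submodule N b e B"
  shows "w \<in> B \<Longrightarrow> w \<in> free_module N b" "0 \<in> B" "w \<in> B \<Longrightarrow> w' \<in> B \<Longrightarrow> w + w' \<in> B"
    "f \<in> poly_ring N \<Longrightarrow> w \<in> B \<Longrightarrow> smul f w \<in> B" "w \<in> B \<Longrightarrow> hcomp_vec e a w \<in> B"
  using assms by (auto simp: graded_submodule_def)

lemma graded_submodule_diff: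
  assumes "graded_submodule N b e B" "w \<in> B" "w' \<in> B"
  shows "w - w' \<in> B"
proof -
  have "w + smul (- 1) w' \<in> B"
    using assms by (intro graded_submoduleD[OF assms(1)] poly_ring_uminus) auto
  moreover have "w + smul (- 1) w' = w - w'" by (simp add: fun_eq_iff)
  ultimately show ?thesis by simp
qed

lemma graded_submodule_sum:
  assumes "graded_submodule N b e B" "\<And>i. i \<in> A \<Longrightarrow> w i \<in> B"
  shows "sum w A \<in> B"
  using assms(2) by (induction A rule: infinite_finite_induct) (auto intro!: graded_submoduleD[OF assms(1)])

lemma graded_submodule_free_module: "graded_submodule N b e (free_module N b)"
  by (auto simp: graded_submodule_def free_module_add free_module_smul hcomp_vec_free_module)

subsection \<open>Graded homomorphisms\<close>

context
  fixes N b :: nat and e :: "nat \<Rightarrow> int" and b' :: nat and e' :: "nat \<Rightarrow> int"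
    and h :: "(nat \<Rightarrow> (nat, 'k::comm_ring_1) mpoly) \<Rightarrow> nat \<Rightarrow> (nat, 'k) mpoly"
  assumes h: "graded_hom N b e b' e' h"
begin

lemma graded_hom_in: "w \<in> free_module N b \<Longrightarrow> h w \<in> free_module N b'"
  using h by (auto simp: graded_hom_def)

lemma graded_hom_add: "w \<in> free_module N b \<Longrightarrow> w' \<in> free_module N b \<Longrightarrow> h (w + w') = h w + h w'"
  using h by (simp add: graded_hom_def plus_fun_def)

lemma graded_hom_smul: "f \<in> poly_ring N \<Longrightarrow> w \<in> free_module N b \<Longrightarrow> h (smul f w) = smul f (h w)"
  using h by (simp add: graded_hom_def smul_def)

lemma graded_hom_homogeneous:
  "w \<in> free_module N b \<Longrightarrow> homogeneous_vec b e a w \<Longrightarrow> homogeneous_vec b' e' a (h w)"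
  using h by (simp add: graded_hom_def)

lemma graded_hom_0: "h 0 = 0"
  using graded_hom_smul[of 0 0] by (simp add: fun_eq_iff)

lemma graded_hom_diff:
  assumes "w \<in> free_module N b" "w' \<in> free_module N b"
  shows "h (w - w') = h w - h w'"
  using graded_hom_add[OF free_module_diff[OF assms] assms(2)] by simp

lemma graded_hom_sum:
  "(\<And>i. i \<in> A \<Longrightarrow> w i \<in> free_module N b) \<Longrightarrow> h (sum w A) = (\<Sum>i\<in>A. h (w i))"
proof (induction A rule: infinite_finite_induct)
  case (insert i A)
  have "sum w A \<in> free_module N b"
    using insert by (intro graded_submodule_sum[OF graded_submodule_free_module]) auto
  then have "h (w i + sum w A) = h (w i) + (\<Sum>i\<in>A. h (w i))"
    using insert graded_hom_add[of "w i" "sum w A"] by (metis insertCI)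
  then show ?case by (simp only: sum.insert[OF insert.hyps])
qed (auto simp: graded_hom_0)

lemma graded_hom_hcomp:
  assumes w: "w \<in> free_module N b"
  shows "h (hcomp_vec e a w) = hcomp_vec e' a (h w)"
proof -
  obtain A where A: "finite A" "\<And>A'. finite A' \<Longrightarrow> A \<subseteq> A' \<Longrightarrow> (\<Sum>a\<in>A'. hcomp_vec e a w) = w"
    using sum_hcomp_vec[OF w] by metis
  \<comment> \<open>Adding \<open>a\<close> guarantees a summand in the degree that is to be
    extracted.\<close>
  let ?A = "insert a A"
  have "h w = h (\<Sum>c\<in>?A. hcomp_vec e c w)" using A by (metis finite_insert subset_insertI)
  also have "\<dots> = (\<Sum>c\<in>?A. h (hcomp_vec e c w))"
    by (rule graded_hom_sum) (rule hcomp_vec_free_module[OF w])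
  finally have "hcomp_vec e' a (h w) = (\<Sum>c\<in>?A. hcomp_vec e' a (h (hcomp_vec e c w)))"
    by (simp add: hcomp_vec_sum)
  also have "\<dots> = (\<Sum>c\<in>?A. if c = a then h (hcomp_vec e a w) else 0)"
  proof (rule sum.cong[OF refl])
    fix c
    have 1: "h (hcomp_vec e c w) \<in> free_module N b'"
      by (intro graded_hom_in hcomp_vec_free_module w)
    have 2: "homogeneous_vec b' e' c (h (hcomp_vec e c w))"
      by (intro graded_hom_homogeneous hcomp_vec_free_module w) simp
    show "hcomp_vec e' a (h (hcomp_vec e c w)) = (if c = a then h (hcomp_vec e a w) else 0)"
      using hcomp_vec_id[OF 1 2] hcomp_vec_other[OF 1 2] by auto
  qed
  also have "\<dots> = h (hcomp_vec e a w)" using A(1) by simp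
  finally show ?thesis by simp
qed

lemma graded_submodule_image: "graded_submodule N b' e' (h ` free_module N b)"
  unfolding graded_submodule_def
proof (intro conjI ballI allI)
  show "h ` free_module N b \<subseteq> free_module N b'" using graded_hom_in by auto
  show "0 \<in> h ` free_module N b" using graded_hom_0 by (metis free_module_0 imageI)
next
  fix w w' assume "w \<in> h ` free_module N b" "w' \<in> h ` free_module N b"
  then show "w + w' \<in> h ` free_module N b"
    by (auto simp: graded_hom_add[symmetric] free_module_add)
next
  fix f :: "(nat, 'k) mpoly" and w assume "f \<in> poly_ring N" "w \<in> h ` free_module N b"
  then show "smul f w \<in> h ` free_module N b"
    by (auto simp: graded_hom_smul[symmetric] free_module_smul)
next
  fix a w assume "w \<in> h ` free_module N b"
  then show "hcomp_vec e' a w \<in> h ` free_module N b"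
    by (auto simp: graded_hom_hcomp[symmetric] hcomp_vec_free_module)
qed

lemma graded_submodule_kernel: "graded_submodule N b e {w \<in> free_module N b. h w = 0}"
  unfolding graded_submodule_def
  by (intro conjI ballI allI CollectI subsetI)
    (auto simp only: mem_Collect_eq free_module_add free_module_smul hcomp_vec_free_module free_module_0
      graded_hom_add graded_hom_smul graded_hom_hcomp graded_hom_0 smul_0 add_0 hcomp_vec_0)

lemma graded_hom_var_mult:
  assumes "z \<in> var_mult X (free_module N b)" "X \<subseteq> {1..N}"
  shows "h z \<in> var_mult X (h ` free_module N b)"
proof -
  obtain g where g: "\<forall>v\<in>X. g v \<in> free_module N b" "z = (\<Sum>v\<in>X. smul (mvar v) (g v))"
    using assms by (auto simp: var_mult_def)
  have "h z = (\<Sum>v\<in>X. h (smul (mvar v) (g v)))"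
    unfolding g by (intro graded_hom_sum free_module_smul poly_ring_mvar) (use g assms in auto)
  also have "\<dots> = (\<Sum>v\<in>X. smul (mvar v) (h (g v)))"
    by (intro sum.cong graded_hom_smul poly_ring_mvar refl) (use g assms in auto)
  finally show ?thesis
    unfolding var_mult_def using g by (intro CollectI exI[of _ "\<lambda>v. h (g v)"]) auto
qed

text \<open>Lifting the coefficients of the variables through \<open>h\<close> gives a preimage that
  itself lies in J times the source module.\<close>

lemma var_mult_imageE:
  assumes "z \<in> var_mult X (h ` free_module N b)" "X \<subseteq> {1..N}"
  obtains y where "y \<in> free_module N b" "y \<in> var_submodule X" "z = h y"
proof -
  obtain g' where g': "\<forall>v\<in>X. g' v \<in> h ` free_module N b" "z = (\<Sum>v\<in>X. smul (mvar v) (g' v))"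
    using assms by (auto simp: var_mult_def)
  then have "\<forall>v\<in>X. \<exists>u. u \<in> free_module N b \<and> g' v = h u" by blast
  then obtain g where g: "\<And>v. v \<in> X \<Longrightarrow> g v \<in> free_module N b" "\<And>v. v \<in> X \<Longrightarrow> g' v = h (g v)"
    by metis
  let ?y = "\<Sum>v\<in>X. smul (mvar v) (g v)"
  have *: "smul (mvar v) (g v) \<in> free_module N b" if "v \<in> X" for v
    using that g assms by (intro free_module_smul poly_ring_mvar) auto
  have "h ?y = (\<Sum>v\<in>X. h (smul (mvar v) (g v)))" by (intro graded_hom_sum *)
  also have "\<dots> = (\<Sum>v\<in>X. smul (mvar v) (g' v))"
  proof (rule sum.cong[OF refl])
    fix v assume v: "v \<in> X"
    then have "mvar v \<in> poly_ring N" using assms(2) by (intro poly_ring_mvar) auto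
    then show "h (smul (mvar v) (g v)) = smul (mvar v) (g' v)"
      using graded_hom_smul[of "mvar v" "g v"] g v by metis
  qed
  finally have "z = h ?y" using g' by simp
  moreover have "?y \<in> free_module N b"
    by (intro graded_submodule_sum[OF graded_submodule_free_module] *)
  moreover have "?y \<in> var_submodule X"
    by (intro var_submodule_sum var_submodule_mvar)
  ultimately show thesis using that by blast
qed

end

subsection \<open>Regularity of variables in single degrees\<close>

text \<open>
  With \<open>F = R(-e 1) \<oplus> \<dots> \<oplus> R(-e b)\<close>, \<open>M = F/B\<close> and \<open>J\<close> the ideal generated by the variables in
  \<open>X\<close>: multiplication by \<open>x\<close> is injective on \<open>M/JM\<close> in degree \<open>a\<close>, respectively \<open>Tor\<^sub>1(M, R/J)\<close>
  vanishes in degree \<open>a\<close>.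
\<close>
definition regular_at ::
  "nat \<Rightarrow> nat \<Rightarrow> (nat \<Rightarrow> int) \<Rightarrow> nat set \<Rightarrow> nat \<Rightarrow> (nat \<Rightarrow> (nat, 'k::comm_ring_1) mpoly) set \<Rightarrow> int \<Rightarrow> bool" where
  "regular_at N b e X x B a \<longleftrightarrow> (\<forall>z\<in>free_module N b. homogeneous_vec b e a z \<longrightarrow>
     (\<exists>y\<in>B. smul (mvar x) z - y \<in> var_submodule X) \<longrightarrow> (\<exists>y\<in>B. z - y \<in> var_submodule X))"

definition tor_vanishes_at ::
  "nat \<Rightarrow> (nat \<Rightarrow> int) \<Rightarrow> nat set \<Rightarrow> (nat \<Rightarrow> (nat, 'k::comm_ring_1) mpoly) set \<Rightarrow> int \<Rightarrow> bool" where
  "tor_vanishes_at b e X B a \<longleftrightarrow>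
     (\<forall>z\<in>B. homogeneous_vec b e a z \<longrightarrow> z \<in> var_submodule X \<longrightarrow> z \<in> var_mult X B)"

lemma var_submodule_hcomp_vec: "w \<in> var_submodule X \<Longrightarrow> hcomp_vec e a w \<in> var_submodule X"
  by (simp add: var_submodule_def hcomp_vec_def hcomp_def var_ideal_pfilter)

lemma var_submodule_minus_commute:
  "w - w' \<in> var_submodule X \<Longrightarrow> w' - w \<in> var_submodule X"
  using var_submodule_diff[OF var_submodule_0, of "w - w'" X] by simp

text \<open>B and J F contain the components of their elements. So \<open>regular_at\<close> may
  quantify over arbitrary \<open>y\<close> and still yield a homogeneous one.\<close>

lemma graded_congruent_component:
  assumes B: "graded_submodule N b e B" and z: "z \<in> free_module N b" "homogeneous_vec b e a z"
    and y: "y \<in> B" "z - y \<in> var_submodule X"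
  shows "\<exists>y'\<in>B. homogeneous_vec b e a y' \<and> z - y' \<in> var_submodule X"
proof (intro bexI conjI)
  show "z - hcomp_vec e a y \<in> var_submodule X"
    using var_submodule_hcomp_vec[OF y(2), of e a] by (simp only: hcomp_vec_diff hcomp_vec_id[OF z])
  show "hcomp_vec e a y \<in> B" by (rule graded_submoduleD(5)[OF B y(1)])
qed simp

lemma tor_vanishes_at_empty: "tor_vanishes_at b e {} B a"
proof -
  have "0 \<in> var_mult {} B"
    unfolding var_mult_def by (intro CollectI exI[of _ undefined] conjI) (simp_all only: sum.empty ball_empty)
  then show ?thesis unfolding tor_vanishes_at_def var_submodule_empty by blast
qed

text \<open>Exactness of Tor_1(M, R/J) -> Tor_1(M, R/(J + x)) -> M/JM(-1) -> M/JM in degree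
  \<open>a + 1\<close>; the twist explains why injectivity is asked in degree
  \<open>a\<close>.\<close>

lemma tor_vanishes_at_insert:
  assumes B: "graded_submodule N b e B" and X: "insert x X \<subseteq> {1..N}" "x \<notin> X"
    and tor: "tor_vanishes_at b e X B (a + 1)" and reg: "regular_at N b e X x B a"
  shows "tor_vanishes_at b e (insert x X) B (a + 1)"
  unfolding tor_vanishes_at_def
proof (intro ballI impI)
  fix z assume z: "z \<in> B" "homogeneous_vec b e (a + 1) z" "z \<in> var_submodule (insert x X)"
  obtain g where g: "g \<in> free_module N b" "z - smul (mvar x) g \<in> var_submodule X"
    "homogeneous_vec b e a g"
    using var_submodule_insert_split[OF z(3) graded_submoduleD(1)[OF B z(1)]] z(2) by blast
  have "smul (mvar x) g - z \<in> var_submodule X"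
    using g(2) by (rule var_submodule_minus_commute)
  then obtain y0 where "y0 \<in> B" "g - y0 \<in> var_submodule X"
    using reg g z(1) unfolding regular_at_def by blast
  then obtain y where y: "y \<in> B" "g - y \<in> var_submodule X" "homogeneous_vec b e a y"
    using graded_congruent_component[OF B g(1,3)] by blast
  \<comment> \<open>Replacing \<open>g\<close> by the congruent \<open>y\<close> from B keeps the
    remainder in J F and also puts it into B, where the hypothesis for \<open>X\<close>
    applies.\<close>
  have "(z - smul (mvar x) g) + smul (mvar x) (g - y) \<in> var_submodule X"
    by (intro var_submodule_add g(2) var_submodule_smul y(2))
  then have J: "z - smul (mvar x) y \<in> var_submodule X"
    by (simp only: smul_diff diff_add_cancel add_diff_eq)
  have "mvar x \<in> poly_ring N" using X by (intro poly_ring_mvar) auto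
  then have "z - smul (mvar x) y \<in> B"
    by (intro graded_submodule_diff[OF B] graded_submoduleD(4)[OF B] z y)
  moreover have "homogeneous_vec b e (a + 1) (z - smul (mvar x) y)"
    by (intro homogeneous_vec_diff homogeneous_vec_mvar z y)
  ultimately have "z - smul (mvar x) y \<in> var_mult X B"
    using tor J unfolding tor_vanishes_at_def by blast
  from var_mult_insertI[OF _ X(2) this y(1)] show "z \<in> var_mult (insert x X) B"
    using X finite_subset[of X "{1..N}"] by (simp only: diff_add_cancel) auto
qed

text \<open>The same exact sequence: the kernel of \<open>x\<close> on M/JM in degree
  \<open>a\<close> is the image of Tor_1(M, R/(J + x)) in degree \<open>a + 1\<close>.\<close>

lemma regular_at_if_tor_vanishes_at:
  assumes B: "graded_submodule N b e B" and X: "insert x X \<subseteq> {1..N}" "x \<notin> X"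
    and tor: "tor_vanishes_at b e (insert x X) B (a + 1)"
  shows "regular_at N b e X x B a"
  unfolding regular_at_def
proof (intro ballI impI)
  fix z assume z: "z \<in> free_module N b" "homogeneous_vec b e a z"
    and "\<exists>y\<in>B. smul (mvar x) z - y \<in> var_submodule X"
  then obtain y0 where y0: "y0 \<in> B" "smul (mvar x) z - y0 \<in> var_submodule X" by blast
  have x: "mvar x \<in> poly_ring N" using X by (intro poly_ring_mvar) auto
  obtain y where y: "y \<in> B" "homogeneous_vec b e (a + 1) y" "smul (mvar x) z - y \<in> var_submodule X"
    using graded_congruent_component[OF B free_module_smul[OF z(1) x] homogeneous_vec_mvar[OF z(2)] y0] by blast
  have "smul (mvar x) z - y \<in> var_submodule (insert x X)"
    using y(3) var_submodule_mono[of X "insert x X"] by blast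
  from var_submodule_diff[OF var_submodule_mvar[of x "insert x X" z] this]
  have "y \<in> var_submodule (insert x X)" by simp
  then have "y \<in> var_mult (insert x X) B"
    using tor y unfolding tor_vanishes_at_def by blast
  then obtain w y' where w: "w \<in> var_mult X B" "y' \<in> B" "y = w + smul (mvar x) y'"
    using var_mult_insertE[OF _ X(2)] X finite_subset[of X "{1..N}"]
    by (metis finite_atLeastAtMost insert_subset)
  have "(smul (mvar x) z - y) + w \<in> var_submodule X"
    using var_submodule_add[OF y(3)] w(1) var_mult_subset by blast
  then have "smul (mvar x) (z - y') \<in> var_submodule X"
    by (simp add: w(3) smul_diff algebra_simps)
  then have "z - y' \<in> var_submodule X" using X(2) by (rule var_submodule_cancel_mvar)
  then show "\<exists>y\<in>B. z - y \<in> var_submodule X" using w(2) by blast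
qed

text \<open>The source modulo the kernel is the syzygy module B. If Tor_1(M, R/J) vanishes in degree
  \<open>a\<close>, then B/JB embeds there into F/JF, on which \<open>x\<close> is a
  nonzerodivisor.\<close>

lemma regular_at_kernel:
  assumes h: "graded_hom N b' e' b e h" and B: "h ` free_module N b' = B"
    and X: "insert x X \<subseteq> {1..N}" "x \<notin> X" and tor: "tor_vanishes_at b e X B a"
  shows "regular_at N b' e' X x {w \<in> free_module N b'. h w = 0} a"
  unfolding regular_at_def
proof (intro ballI impI)
  fix z assume z: "z \<in> free_module N b'" "homogeneous_vec b' e' a z"
    and "\<exists>y\<in>{w \<in> free_module N b'. h w = 0}. smul (mvar x) z - y \<in> var_submodule X"
  then obtain y where y: "y \<in> free_module N b'" "h y = 0" "smul (mvar x) z - y \<in> var_submodule X"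
    by blast
  have x: "mvar x \<in> poly_ring N" and X': "X \<subseteq> {1..N}" and fin: "finite X"
    using X finite_subset[of X "{1..N}"] by (auto intro: poly_ring_mvar)
  have F: "smul (mvar x) z - y \<in> free_module N b'"
    by (intro free_module_diff free_module_smul z y x)
  from graded_hom_var_mult[OF h var_submodule_eq_var_mult[OF fin F y(3) X'] X']
  have "h (smul (mvar x) z - y) \<in> var_submodule X" using var_mult_subset by blast
  also have "h (smul (mvar x) z - y) = smul (mvar x) (h z)"
    using graded_hom_diff[OF h free_module_smul[OF z(1) x] y(1)] graded_hom_smul[OF h x z(1)] y(2) by simp
  finally have "h z \<in> var_submodule X" using X(2) by (rule var_submodule_cancel_mvar)
  moreover have "h z \<in> B" using z B by blast
  ultimately have "h z \<in> var_mult X (h ` free_module N b')"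
    using tor graded_hom_homogeneous[OF h z] B unfolding tor_vanishes_at_def by blast
  then obtain u where u: "u \<in> free_module N b'" "u \<in> var_submodule X" "h z = h u"
    using var_mult_imageE[OF h _ X'] by metis
  \<comment> \<open>\<open>u\<close> lies in J times the source and has the same image as
    \<open>z\<close>, so \<open>z - u\<close> is the required congruent element of the
    kernel.\<close>
  have "z - u \<in> {w \<in> free_module N b'. h w = 0}"
    using graded_hom_diff[OF h z(1) u(1)] u free_module_diff[OF z(1) u(1)] by simp
  moreover have "z - (z - u) \<in> var_submodule X" using u by simp
  ultimately show "\<exists>y\<in>{w \<in> free_module N b'. h w = 0}. z - y \<in> var_submodule X" by blast
qed

lemma homogeneous_preimage:
  assumes h: "graded_hom N b' e' b e h" and z: "z \<in> h ` free_module N b'" "homogeneous_vec b e a z"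
  obtains w where "w \<in> free_module N b'" "homogeneous_vec b' e' a w" "z = h w"
proof -
  obtain u where u: "u \<in> free_module N b'" "z = h u" using z by blast
  have "h (hcomp_vec e' a u) = z"
    using graded_hom_hcomp[OF h u(1), of a] hcomp_vec_id[OF graded_hom_in[OF h u(1)], of e a] z(2) u(2) by simp
  then show thesis using that hcomp_vec_free_module[OF u(1)] by (metis homogeneous_hcomp_vec)
qed

text \<open>A nonzero class of Tor_1 in degree \<open>a\<close> is an element of B in J F but not in
  J B. Its multiple by \<open>x\<close> lies in J B because Tor_1 vanishes in degree
  \<open>a + 1\<close>, so \<open>x\<close> kills a nonzero class of B/JB.\<close>

lemma not_regular_at_kernel:
  assumes h: "graded_hom N b' e' b e h" and B: "h ` free_module N b' = B"
    and X: "insert x X \<subseteq> {1..N}" and tor: "tor_vanishes_at b e X B (a + 1)" "\<not> tor_vanishes_at b e X B a"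
  shows "\<not> regular_at N b' e' X x {w \<in> free_module N b'. h w = 0} a"
proof
  assume reg: "regular_at N b' e' X x {w \<in> free_module N b'. h w = 0} a"
  have x: "mvar x \<in> poly_ring N" and X': "X \<subseteq> {1..N}" and fin: "finite X"
    using X finite_subset[of X "{1..N}"] by (auto intro: poly_ring_mvar)
  obtain z where z: "z \<in> B" "homogeneous_vec b e a z" "z \<in> var_submodule X" "z \<notin> var_mult X B"
    using tor(2) unfolding tor_vanishes_at_def by blast
  obtain w where w: "w \<in> free_module N b'" "homogeneous_vec b' e' a w" "z = h w"
    using homogeneous_preimage[OF h] z B by metis
  have xw: "smul (mvar x) w \<in> free_module N b'" by (intro free_module_smul w x)
  have hxw: "h (smul (mvar x) w) = smul (mvar x) z"
    using graded_hom_smul[OF h x w(1)] w(3) by simp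
  then have "smul (mvar x) z \<in> B" using xw B by (metis imageI)
  moreover have "homogeneous_vec b e (a + 1) (smul (mvar x) z)" by (rule homogeneous_vec_mvar[OF z(2)])
  moreover have "smul (mvar x) z \<in> var_submodule X" by (rule var_submodule_smul[OF z(3)])
  ultimately have "smul (mvar x) z \<in> var_mult X (h ` free_module N b')"
    using tor(1) B unfolding tor_vanishes_at_def by blast
  then obtain u where u: "u \<in> free_module N b'" "u \<in> var_submodule X" "smul (mvar x) z = h u"
    using var_mult_imageE[OF h _ X'] by metis
  have "smul (mvar x) w - u \<in> {w \<in> free_module N b'. h w = 0}"
    using graded_hom_diff[OF h xw u(1)] u free_module_diff[OF xw u(1)] hxw by simp
  moreover have "smul (mvar x) w - (smul (mvar x) w - u) \<in> var_submodule X" using u by simp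
  ultimately obtain y where y: "y \<in> free_module N b'" "h y = 0" "w - y \<in> var_submodule X"
    using reg w unfolding regular_at_def by blast
  have F: "w - y \<in> free_module N b'" by (intro free_module_diff w y)
  from graded_hom_var_mult[OF h var_submodule_eq_var_mult[OF fin F y(3) X'] X']
  have "h (w - y) \<in> var_mult X B" using B by simp
  also have "h (w - y) = z" using graded_hom_diff[OF h w(1) y(1)] y w by simp
  finally show False using z by simp
qed

definition unit_vec :: "nat \<Rightarrow> nat \<Rightarrow> 'a::zero_neq_one" where
  "unit_vec j = (\<lambda>i. if i = j then 1 else 0)"

text \<open>A basis vector of degree \<open>a\<close> would have its image in m B, with m the
  irrelevant ideal. It would then agree, up to an element of the kernel, with a vector of m F', and
  minimality puts the kernel inside m F' as well.\<close>

lemma no_generator_in_degree: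
  assumes h: "graded_hom N b' e' b e h" and B: "h ` free_module N b' = B" "B \<subseteq> var_submodule {1..N}"
    and ker: "\<And>w. w \<in> free_module N b' \<Longrightarrow> h w = 0 \<Longrightarrow> w \<in> var_submodule {1..N}"
    and tor: "tor_vanishes_at b e {1..N} B a" and j: "j \<in> {1..b'}"
  shows "e' j \<noteq> a"
proof
  assume a: "e' j = a"
  let ?w = "unit_vec j :: nat \<Rightarrow> (nat, 'a) mpoly"
  have w: "?w \<in> free_module N b'" "homogeneous_vec b' e' a ?w"
    using j a by (auto simp: free_module_def homogeneous_vec_def unit_vec_def)
  have "h ?w \<in> B" using w B by blast
  then have "h ?w \<in> var_mult {1..N} (h ` free_module N b')"
    using tor graded_hom_homogeneous[OF h w] B unfolding tor_vanishes_at_def by blast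
  then obtain u where u: "u \<in> free_module N b'" "u \<in> var_submodule {1..N}" "h ?w = h u"
    using var_mult_imageE[OF h] by blast
  have "?w - u \<in> var_submodule {1..N}"
    using graded_hom_diff[OF h w(1) u(1)] u by (intro ker free_module_diff w) simp_all
  from var_submodule_add[OF this u(2)] have "?w \<in> var_submodule {1..N}" by simp
  then have "(1 :: (nat, 'a) mpoly) \<in> var_ideal {1..N}"
    unfolding var_submodule_def by (auto simp: unit_vec_def split: if_splits)
  then show False by (auto simp: var_ideal_def)
qed

lemma homogeneous_in_var_ideal:
  assumes "f \<in> poly_ring N" "homogeneous a f" "a \<noteq> 0"
  shows "f \<in> var_ideal {1..N}"
proof -
  have "0 \<notin> Poly_Mapping.keys f" using assms by (auto simp: homogeneous_def)
  then have "f \<in> irrelevant_ideal N" using assms by (simp add: irrelevant_ideal_def in_keys_iff)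
  then show ?thesis by (simp add: irrelevant_ideal_eq)
qed

text \<open>If no basis vector has degree \<open>a\<close>, every homogeneous vector of degree
  \<open>a\<close> has its coordinates in the irrelevant ideal, and so has its image in m B.\<close>

lemma tor_vanishes_at_if_no_generator:
  assumes h: "graded_hom N b' e' b e h" and B: "h ` free_module N b' = B"
    and no: "\<And>j. j \<in> {1..b'} \<Longrightarrow> e' j \<noteq> a"
  shows "tor_vanishes_at b e {1..N} B a"
  unfolding tor_vanishes_at_def
proof (intro ballI impI)
  fix z assume "z \<in> B" "homogeneous_vec b e a z"
  then obtain w where w: "w \<in> free_module N b'" "homogeneous_vec b' e' a w" "z = h w"
    using homogeneous_preimage[OF h] B by metis
  have "w j \<in> var_ideal {1..N}" for j
  proof (cases "j \<in> {1..b'}")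
    case True
    have "homogeneous (a - e' j) (w j)" using w(2) True by (simp add: homogeneous_vec_def)
    moreover have "a - e' j \<noteq> 0" using no[OF True] by simp
    ultimately show ?thesis using homogeneous_in_var_ideal[OF free_module_apply[OF w(1)]] by blast
  next
    case False
    then have "w j = 0" using w by (auto simp: free_module_def)
    then show ?thesis by simp
  qed
  then have "w \<in> var_submodule {1..N}" by (simp add: var_submodule_def)
  from graded_hom_var_mult[OF h var_submodule_eq_var_mult[OF _ w(1) this]]
  show "z \<in> var_mult {1..N} B" using B w(3) by auto
qed

subsection \<open>Propagation along a resolution\<close>

text \<open>
  For \<open>i = 0\<close> this says that \<open>xs 0, \<dots>, xs (c - 1)\<close> is a regular sequence on \<open>M = F/B\<close>, and that
  each further variable is injective, in degrees above \<open>r\<close>, on the quotient of \<open>M\<close> by its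
  predecessors. Passing to the syzygy module raises \<open>c\<close> and \<open>r\<close> by one.
\<close>
definition regular_chain ::
  "nat \<Rightarrow> (nat \<Rightarrow> nat) \<Rightarrow> nat \<Rightarrow> int \<Rightarrow> nat \<Rightarrow> nat \<Rightarrow> (nat \<Rightarrow> int) \<Rightarrow> (nat \<Rightarrow> (nat, 'k::comm_ring_1) mpoly) set \<Rightarrow> bool" where
  "regular_chain N xs c r i b e B \<longleftrightarrow>
     (\<forall>s<N. \<forall>a. s < c + i \<or> a > r + int i \<longrightarrow> regular_at N b e (xs ` {..<s}) (xs s) B a)"

context
  fixes N :: nat and xs :: "nat \<Rightarrow> nat"
  assumes xs: "bij_betw xs {..<N} {1..N}"
begin

lemma xs_initial:
  assumes "s < N"
  shows "insert (xs s) (xs ` {..<s}) \<subseteq> {1..N}" "xs s \<notin> xs ` {..<s}"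
    "xs ` {..<Suc s} = insert (xs s) (xs ` {..<s})"
proof -
  have inj: "inj_on xs {..<N}" and im: "xs ` {..<N} = {1..N}" using xs by (auto simp: bij_betw_def)
  show "insert (xs s) (xs ` {..<s}) \<subseteq> {1..N}" using im assms by force
  show "xs s \<notin> xs ` {..<s}"
  proof
    assume "xs s \<in> xs ` {..<s}"
    then obtain t where "t < s" "xs s = xs t" by auto
    then show False using inj_onD[OF inj, of s t] assms by simp
  qed
  show "xs ` {..<Suc s} = insert (xs s) (xs ` {..<s})" by (simp add: lessThan_Suc)
qed

lemma xs_all: "xs ` {..<N} = {1..N}"
  using xs by (simp add: bij_betw_def)

text \<open>The variables are added one at a time. Each addition needs injectivity in degree
  \<open>a - 1\<close>, hence the extra 1 in the bound on \<open>a\<close>.\<close>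

lemma regular_chain_tor:
  assumes B: "graded_submodule N b e B" and Q: "regular_chain N xs c r i b e B"
    and s: "s \<le> N" and a: "s \<le> c + i \<or> a > r + int i + 1"
  shows "tor_vanishes_at b e (xs ` {..<s}) B a"
  using s a
proof (induction s)
  case 0
  then show ?case by (simp add: tor_vanishes_at_empty)
next
  case (Suc s)
  have "tor_vanishes_at b e (xs ` {..<s}) B (a - 1 + 1)" using Suc by auto
  moreover have "regular_at N b e (xs ` {..<s}) (xs s) B (a - 1)"
    using Q Suc.prems unfolding regular_chain_def by auto
  ultimately show ?case
    using tor_vanishes_at_insert[OF B xs_initial(1,2), of s "a - 1"] Suc.prems xs_initial(3)[of s] by simp
qed

text \<open>On the syzygy module, injectivity in degree \<open>a\<close> comes from vanishing of
  Tor_1 in the same degree. The ranges of \<open>regular_chain_tor\<close> thus become the new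
  ranges, with \<open>c\<close> and \<open>r\<close> effectively raised by one.\<close>

lemma regular_chain_kernel:
  assumes h: "graded_hom N b' e' b e h" and B: "h ` free_module N b' = B"
    and Q: "regular_chain N xs c r i b e B"
  shows "regular_chain N xs c r (Suc i) b' e' {w \<in> free_module N b'. h w = 0}"
  unfolding regular_chain_def
proof (intro allI impI)
  fix s a assume s: "s < N" and a: "s < c + Suc i \<or> r + int (Suc i) < a"
  have gB: "graded_submodule N b e B" using graded_submodule_image[OF h] B by simp
  have "tor_vanishes_at b e (xs ` {..<s}) B a"
    using s a by (intro regular_chain_tor[OF gB Q]) auto
  then show "regular_at N b' e' (xs ` {..<s}) (xs s) {w \<in> free_module N b'. h w = 0} a"
    by (rule regular_at_kernel[OF h B xs_initial(1,2)[OF s]])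
qed

lemma not_regular_chain_tor:
  assumes B: "graded_submodule N b e B" and s: "c + i < N"
    and nreg: "\<not> regular_at N b e (xs ` {..<c + i}) (xs (c + i)) B (r + int i)"
  shows "\<not> tor_vanishes_at b e (xs ` {..<Suc (c + i)}) B (r + int i + 1)"
  using regular_at_if_tor_vanishes_at[OF B xs_initial(1,2)[OF s]] nreg xs_initial(3)[OF s] by metis

text \<open>The failure makes Tor_1 for the next initial segment nonzero in degree
  \<open>r + i + 1\<close>, while the chain gives vanishing in degree \<open>r + i + 2\<close>. So
  the failure moves on to the next variable and the next degree.\<close>

lemma not_regular_chain_kernel:
  assumes h: "graded_hom N b' e' b e h" and B: "h ` free_module N b' = B"
    and Q: "regular_chain N xs c r i b e B" and s: "c + Suc i < N"
    and nreg: "\<not> regular_at N b e (xs ` {..<c + i}) (xs (c + i)) B (r + int i)"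
  shows "\<not> regular_at N b' e' (xs ` {..<c + Suc i}) (xs (c + Suc i)) {w \<in> free_module N b'. h w = 0} (r + int (Suc i))"
proof -
  have gB: "graded_submodule N b e B" using graded_submodule_image[OF h] B by simp
  have "\<not> tor_vanishes_at b e (xs ` {..<c + Suc i}) B (r + int (Suc i))"
    using not_regular_chain_tor[OF gB _ nreg] s by (simp add: algebra_simps)
  moreover have "tor_vanishes_at b e (xs ` {..<c + Suc i}) B (r + int (Suc i) + 1)"
    using s by (intro regular_chain_tor[OF gB Q]) auto
  ultimately show ?thesis
    using not_regular_at_kernel[OF h B xs_initial(1)[OF s]] by blast
qed

text \<open>The upper bound uses the whole chain at every step; the lower bound follows one failure
  until it reaches the last variable.\<close>

lemma resolution_degrees:
  fixes d :: "nat \<Rightarrow> (nat \<Rightarrow> (nat, 'k::field) mpoly) \<Rightarrow> nat \<Rightarrow> (nat, 'k) mpoly"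
  assumes res: "minimal_graded_free_resolution N I p \<beta> e d"
    and Q: "regular_chain N xs c r 0 1 (e 0) {w \<in> free_module N 1. w 1 \<in> I}"
    and nreg: "\<not> regular_at N 1 (e 0) (xs ` {..<c}) (xs c) {w \<in> free_module N 1. w 1 \<in> I} r"
    and c: "c < N"
  shows "i \<ge> 1 \<Longrightarrow> j \<in> {1..\<beta> i} \<Longrightarrow> e i j - int i \<le> r"
    and "\<exists>i j. i \<in> {1..p} \<and> j \<in> {1..\<beta> i} \<and> e i j - int i = r"
proof -
  \<comment> \<open>F_i modulo \<open>B i\<close> is the i-th syzygy module, R/I itself for
    \<open>i = 0\<close>. Exactness identifies \<open>B (Suc i)\<close> with the kernel of
    \<open>d (Suc i)\<close>, as the kernel lemmas require.\<close>
  define B where "B i = d (Suc i) ` free_module N (\<beta> (Suc i))" for i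
  have h: "graded_hom N (\<beta> (Suc i)) (e (Suc i)) (\<beta> i) (e i) (d (Suc i))" for i
    using res unfolding minimal_graded_free_resolution_def by (elim conjE) (drule spec[of _ "Suc i"], simp)
  have B0: "B 0 = {w \<in> free_module N 1. w 1 \<in> I}"
    using res unfolding minimal_graded_free_resolution_def B_def by simp
  have BSuc: "B (Suc i) = {w \<in> free_module N (\<beta> (Suc i)). d (Suc i) w = 0}" for i
  proof -
    have "\<forall>i\<ge>1. d (i + 1) ` free_module N (\<beta> (i + 1)) = {w \<in> free_module N (\<beta> i). d i w = (\<lambda>j. 0)}"
      using res unfolding minimal_graded_free_resolution_def by (elim conjE)
    from this[rule_format, of "Suc i"] show ?thesis by (simp add: B_def zero_fun_def)
  qed
  have \<beta>0: "\<beta> 0 = 1" using res unfolding minimal_graded_free_resolution_def by simp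
  have gB: "graded_submodule N (\<beta> i) (e i) (B i)" for i
    unfolding B_def by (rule graded_submodule_image[OF h])
  have min: "d (Suc i) w j \<in> irrelevant_ideal N"
    if "w \<in> free_module N (\<beta> (Suc i))" "j \<in> {1..\<beta> i}" for i w j
  proof -
    have "\<forall>i\<ge>1. \<forall>w\<in>free_module N (\<beta> i). \<forall>j\<in>{1..\<beta> (i - 1)}. d i w j \<in> irrelevant_ideal N"
      using res unfolding minimal_graded_free_resolution_def by (elim conjE)
    from this[rule_format, of "Suc i" w j] show ?thesis using that by simp
  qed
  have mB: "B i \<subseteq> var_submodule {1..N}" for i
  proof
    fix z assume z: "z \<in> B i"
    then obtain w where w: "w \<in> free_module N (\<beta> (Suc i))" "z = d (Suc i) w" by (auto simp: B_def)
    have "z j \<in> var_ideal {1..N}" for j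
    proof (cases "j \<in> {1..\<beta> i}")
      case True
      then have "z j \<in> irrelevant_ideal N"
        using min w by simp
      then show ?thesis by (simp add: irrelevant_ideal_eq)
    next
      case False
      then have "z j = 0" using graded_submoduleD(1)[OF gB z] by (auto simp: free_module_def)
      then show ?thesis by simp
    qed
    then show "z \<in> var_submodule {1..N}" by (simp add: var_submodule_def)
  qed
  have Qi: "regular_chain N xs c r i (\<beta> i) (e i) (B i)" for i
  proof (induction i)
    case 0
    then show ?case using Q B0 \<beta>0 by simp
  next
    case (Suc i)
    show ?case using regular_chain_kernel[OF h B_def[symmetric] Suc.IH] by (simp only: BSuc)
  qed
  have nregi: "\<not> regular_at N (\<beta> i) (e i) (xs ` {..<c + i}) (xs (c + i)) (B i) (r + int i)" if "c + i < N" for i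
    using that
  proof (induction i)
    case 0
    then show ?case using nreg B0 \<beta>0 by simp
  next
    case (Suc i)
    then show ?case
      using not_regular_chain_kernel[OF h B_def[symmetric] Qi Suc.prems] by (simp add: BSuc)
  qed
  show "e i j - int i \<le> r" if ij: "i \<ge> 1" "j \<in> {1..\<beta> i}"
  proof (rule ccontr)
    assume gt: "\<not> e i j - int i \<le> r"
    obtain i' where i': "i = Suc i'" using ij(1) by (cases i) auto
    have "tor_vanishes_at (\<beta> i') (e i') {1..N} (B i') (e i j)"
      using regular_chain_tor[OF gB Qi order_refl] gt i' xs_all by auto
    moreover have "w \<in> var_submodule {1..N}" if "w \<in> free_module N (\<beta> i)" "d i w = 0" for w
      using that BSuc[of i'] mB[of "Suc i'"] i' by blast
    ultimately show False
      using no_generator_in_degree[OF h B_def[symmetric] mB, of i'] ij(2) i' by blast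
  qed
  \<comment> \<open>At this step the failing variable is the last one, and adjoining it gives the
    irrelevant ideal.\<close>
  define i where "i = N - c - 1"
  have ci: "c + i < N" "Suc (c + i) = N" using c by (auto simp: i_def)
  have "\<not> tor_vanishes_at (\<beta> i) (e i) {1..N} (B i) (r + int i + 1)"
    using not_regular_chain_tor[OF gB ci(1) nregi[OF ci(1)]] unfolding ci(2) xs_all .
  then obtain j where j: "j \<in> {1..\<beta> (Suc i)}" "e (Suc i) j = r + int i + 1"
    using tor_vanishes_at_if_no_generator[OF h B_def[symmetric]] by blast
  have "\<forall>i>p. \<beta> i = 0"
    using res unfolding minimal_graded_free_resolution_def by (elim conjE)
  then have "Suc i \<le> p" using j(1) by (cases "Suc i \<le> p") auto
  then show "\<exists>i j. i \<in> {1..p} \<and> j \<in> {1..\<beta> i} \<and> e i j - int i = r"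
    using j by (intro exI[of _ "Suc i"] exI[of _ j]) auto
qed

lemma resolution_regularity:
  fixes d :: "nat \<Rightarrow> (nat \<Rightarrow> (nat, 'k::field) mpoly) \<Rightarrow> nat \<Rightarrow> (nat, 'k) mpoly"
  assumes res: "minimal_graded_free_resolution N I p \<beta> e d"
    and Q: "regular_chain N xs c r 0 1 (e 0) {w \<in> free_module N 1. w 1 \<in> I}"
    and nreg: "\<not> regular_at N 1 (e 0) (xs ` {..<c}) (xs c) {w \<in> free_module N 1. w 1 \<in> I} r"
    and c: "c < N"
  shows "Max {e i j - int i | i j. i \<in> {1..p} \<and> j \<in> {1..\<beta> i}} = r"
proof (rule Max_eqI)
  have "{e i j - int i | i j. i \<in> {1..p} \<and> j \<in> {1..\<beta> i}}
      = (\<lambda>(i, j). e i j - int i) ` Sigma {1..p} (\<lambda>i. {1..\<beta> i})"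
    by (auto simp: image_iff) blast
  then show "finite {e i j - int i | i j. i \<in> {1..p} \<and> j \<in> {1..\<beta> i}}" by simp
  show "y \<le> r" if "y \<in> {e i j - int i | i j. i \<in> {1..p} \<and> j \<in> {1..\<beta> i}}" for y
    using that resolution_degrees(1)[OF res Q nreg c] by auto
  show "r \<in> {e i j - int i | i j. i \<in> {1..p} \<and> j \<in> {1..\<beta> i}}"
    using resolution_degrees(2)[OF res Q nreg c] by blast
qed

end

subsection \<open>Minimal homogeneous generators\<close>

text \<open>For finite \<open>G\<close>, the submodule that it generates, with coefficients indexed
  by the generators themselves.\<close>

definition poly_span ::
  "nat \<Rightarrow> (nat \<Rightarrow> (nat, 'k::comm_ring_1) mpoly) set \<Rightarrow> (nat \<Rightarrow> (nat, 'k) mpoly) set" where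
  "poly_span N G = {z. \<exists>f. (\<forall>g\<in>G. f g \<in> poly_ring N) \<and> z = (\<Sum>g\<in>G. smul (f g) g)}"

lemma smul_zero_left [simp]: "smul 0 w = (0 :: 'i \<Rightarrow> 'a::ring)"
  by (simp add: fun_eq_iff)

lemma smul_one_left [simp]: "smul 1 w = (w :: 'i \<Rightarrow> 'a::ring_1)"
  by (simp add: fun_eq_iff)

lemma smul_add_left: "smul (f + g) w = smul f w + smul g (w :: 'i \<Rightarrow> 'a::ring)"
  by (simp add: fun_eq_iff algebra_simps)

lemma smul_smul: "smul f (smul g w) = smul (f * g) (w :: 'i \<Rightarrow> 'a::ring)"
  by (simp add: fun_eq_iff mult.assoc)

lemma poly_spanI:
  "(\<And>g. g \<in> G \<Longrightarrow> f g \<in> poly_ring N) \<Longrightarrow> (\<Sum>g\<in>G. smul (f g) g) \<in> poly_span N G"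
  by (auto simp: poly_span_def)

lemma poly_span_0: "0 \<in> poly_span N G"
  using poly_spanI[of G "\<lambda>_. 0" N] by simp

lemma poly_span_add:
  assumes "z \<in> poly_span N G" "z' \<in> poly_span N G"
  shows "z + z' \<in> poly_span N G"
proof -
  obtain f f' where f: "\<forall>g\<in>G. f g \<in> poly_ring N" "z = (\<Sum>g\<in>G. smul (f g) g)"
    "\<forall>g\<in>G. f' g \<in> poly_ring N" "z' = (\<Sum>g\<in>G. smul (f' g) g)"
    using assms by (auto simp: poly_span_def)
  have "z + z' = (\<Sum>g\<in>G. smul (f g + f' g) g)"
    unfolding f(2,4) by (simp only: smul_add_left sum.distrib)
  then show ?thesis using poly_spanI[of G "\<lambda>g. f g + f' g" N] f by (simp only: poly_ring_add)
qed

lemma poly_span_smul: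
  assumes "p \<in> poly_ring N" "z \<in> poly_span N G"
  shows "smul p z \<in> poly_span N G"
proof -
  obtain f where f: "\<forall>g\<in>G. f g \<in> poly_ring N" "z = (\<Sum>g\<in>G. smul (f g) g)"
    using assms by (auto simp: poly_span_def)
  have "smul p z = (\<Sum>g\<in>G. smul (p * f g) g)"
    unfolding f(2) by (simp only: smul_sum smul_smul)
  then show ?thesis using poly_spanI[of G "\<lambda>g. p * f g" N] f assms by (simp only: poly_ring_mult)
qed

lemma poly_span_sum: "(\<And>i. i \<in> A \<Longrightarrow> w i \<in> poly_span N G) \<Longrightarrow> sum w A \<in> poly_span N G"
proof (induction A rule: infinite_finite_induct)
  case (insert i A)
  then have "w i + sum w A \<in> poly_span N G" by (intro poly_span_add) auto
  then show ?case by (simp only: sum.insert[OF insert.hyps])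
qed (simp_all add: poly_span_0)

lemma poly_span_base:
  assumes "finite G" "g \<in> G"
  shows "g \<in> poly_span N G"
proof -
  have "(\<Sum>x\<in>G. smul (if x = g then 1 else 0) x) = (\<Sum>x\<in>{g}. smul (if x = g then 1 else 0) x)"
    using assms by (intro sum.mono_neutral_right) auto
  then have "(\<Sum>x\<in>G. smul (if x = g then 1 else 0) x) = g"
    by (simp only: sum.insert[OF finite.emptyI] sum.empty empty_iff not_False_eq_True add_0_right
        smul_one_left if_True simp_thms)
  then show ?thesis using poly_spanI[of G "\<lambda>x. if x = g then 1 else 0" N]
    by (metis (no_types, lifting) poly_ring_0 poly_ring_1)
qed

lemma poly_span_minimal:
  assumes "G \<subseteq> poly_span N G'"
  shows "poly_span N G \<subseteq> poly_span N G'"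
proof
  fix z assume "z \<in> poly_span N G"
  then obtain f where f: "\<forall>g\<in>G. f g \<in> poly_ring N" "z = (\<Sum>g\<in>G. smul (f g) g)"
    by (auto simp: poly_span_def)
  show "z \<in> poly_span N G'"
    unfolding f(2) using f(1) assms by (intro poly_span_sum poly_span_smul) auto
qed

section \<open>Finite dimension of homogeneous parts\<close>

lemma finite_monomials: "finite {t :: nat \<Rightarrow>\<^sub>0 nat. Poly_Mapping.keys t \<subseteq> {1..N} \<and> mon_degree t = k}"
  (is "finite ?S")
proof (rule finite_imageD)
  have "Poly_Mapping.lookup ` ?S \<subseteq> {f. \<forall>x. (x \<in> {1..N} \<longrightarrow> f x \<in> {0..k}) \<and> (x \<notin> {1..N} \<longrightarrow> f x = 0)}"
  proof clarify
    fix t :: "nat \<Rightarrow>\<^sub>0 nat" and x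
    assume t: "Poly_Mapping.keys t \<subseteq> {1..N}" "k = mon_degree t"
    have "Poly_Mapping.lookup t x \<le> mon_degree t"
      by (cases "x \<in> Poly_Mapping.keys t")
        (auto simp: mon_degree_def in_keys_iff intro: member_le_sum)
    then show "(x \<in> {1..N} \<longrightarrow> Poly_Mapping.lookup t x \<in> {0..mon_degree t})
        \<and> (x \<notin> {1..N} \<longrightarrow> Poly_Mapping.lookup t x = 0)"
      using t by (auto simp: in_keys_iff subset_iff)
  qed
  then show "finite (Poly_Mapping.lookup ` ?S)"
    by (rule finite_subset) (rule finite_set_of_finite_funs, simp_all)
qed (simp add: inj_on_def poly_mapping.lookup_inject)

lemma mconst_add: "mconst (c + d) = mconst c + mconst d"
  by (simp add: mconst_def single_add)

lemma mconst_mult: "mconst (c * d) = mconst c * mconst d"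
  by (simp add: mconst_def mult_single)

lemma mconst_1: "mconst 1 = 1"
  by (simp add: mconst_def)

text \<open>Gives access to linear algebra over K, so that a finite basis can be extracted from each
  homogeneous part.\<close>

lemma vector_space_mconst:
  "vector_space (\<lambda>(c::'k::field) (w :: nat \<Rightarrow> (nat, 'k) mpoly). smul (mconst c) w)"
  unfolding vector_space_def
proof (intro conjI allI)
  fix c d :: 'k and w w' :: "nat \<Rightarrow> (nat, 'k) mpoly"
  show "smul (mconst c) (w + w') = smul (mconst c) w + smul (mconst c) w'" by (rule smul_add)
  show "smul (mconst (c + d)) w = smul (mconst c) w + smul (mconst d) w"
    unfolding mconst_add by (rule smul_add_left)
  show "smul (mconst c) (smul (mconst d) w) = smul (mconst (c * d)) w"
    unfolding mconst_mult by (rule smul_smul)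
  show "smul (mconst 1) w = w" unfolding mconst_1 by (rule smul_one_left)
qed

text \<open>Finitely many monomial vectors span degree \<open>a\<close> of the free module over K,
  so a maximal independent subset of the degree \<open>a\<close> part of B is finite.\<close>

lemma homogeneous_part_finite_dimensional:
  fixes B :: "(nat \<Rightarrow> (nat, 'k::field) mpoly) set"
  assumes B: "B \<subseteq> free_module N b"
  shows "\<exists>T. finite T \<and> T \<subseteq> {z \<in> B. homogeneous_vec b e a z} \<and> {z \<in> B. homogeneous_vec b e a z} \<subseteq> poly_span N T"
proof -
  interpret vs: vector_space "\<lambda>(c::'k) (w :: nat \<Rightarrow> (nat, 'k) mpoly). smul (mconst c) w"
    by (rule vector_space_mconst)
  let ?S = "{z \<in> B. homogeneous_vec b e a z}"
  define mv :: "nat \<times> (nat \<Rightarrow>\<^sub>0 nat) \<Rightarrow> nat \<Rightarrow> (nat, 'k) mpoly"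
    where "mv = (\<lambda>(j, t) i. if i = j then Poly_Mapping.single t 1 else 0)"
  \<comment> \<open>For \<open>a < e j\<close> the function \<open>nat\<close> admits the monomial
    1; this is harmless, as \<open>M\<close> only has to bound the span from above.\<close>
  define M where "M = mv ` Sigma {1..b} (\<lambda>j. {t. Poly_Mapping.keys t \<subseteq> {1..N} \<and> mon_degree t = nat (a - e j)})"
  have "finite M" unfolding M_def by (intro finite_imageI finite_SigmaI finite_monomials) simp
  have "?S \<subseteq> vs.span M"
  proof clarify
    fix z assume z: "z \<in> B" "homogeneous_vec b e a z"
    then have zF: "z \<in> free_module N b" using B by blast
    have "z = (\<Sum>j\<in>{1..b}. \<Sum>t\<in>Poly_Mapping.keys (z j). smul (mconst (Poly_Mapping.lookup (z j) t)) (mv (j, t)))"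
    proof
      fix i
      have "(\<Sum>j\<in>{1..b}. \<Sum>t\<in>Poly_Mapping.keys (z j). smul (mconst (Poly_Mapping.lookup (z j) t)) (mv (j, t))) i
          = (\<Sum>j\<in>{1..b}. if i = j then (\<Sum>t\<in>Poly_Mapping.keys (z j). Poly_Mapping.single t (Poly_Mapping.lookup (z j) t)) else 0)"
        unfolding sum_fun_apply
        by (intro sum.cong refl) (simp add: mv_def mconst_def mult_single)
      also have "\<dots> = (if i \<in> {1..b} then pfilter (\<lambda>_. True) (z i) else 0)"
        by (simp add: pfilter_def)
      also have "\<dots> = z i"
        using zF by (auto simp: free_module_def poly_mapping_eq_iff lookup_pfilter fun_eq_iff)
      finally show "z i = (\<Sum>j\<in>{1..b}. \<Sum>t\<in>Poly_Mapping.keys (z j). smul (mconst (Poly_Mapping.lookup (z j) t)) (mv (j, t))) i" ..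
    qed
    also have "\<dots> \<in> vs.span M"
    proof (intro vs.span_sum vs.span_scale vs.span_base)
      fix j t assume j: "j \<in> {1..b}" and t: "t \<in> Poly_Mapping.keys (z j)"
      have "int (mon_degree t) = a - e j"
        using z(2) j t by (auto simp: homogeneous_vec_def homogeneous_def)
      moreover have "Poly_Mapping.keys t \<subseteq> {1..N}"
        using free_module_apply[OF zF] t by (auto simp: poly_ring_def)
      ultimately show "mv (j, t) \<in> M" unfolding M_def using j by (intro imageI) auto
    qed
    finally show "z \<in> vs.span M" .
  qed
  obtain T where T: "T \<subseteq> ?S" "vs.independent T" "?S \<subseteq> vs.span T"
    using vs.maximal_independent_subset by blast
  have "finite T"
    using vs.independent_span_bound[OF \<open>finite M\<close> T(2)] T(1) \<open>?S \<subseteq> vs.span M\<close> by blast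
  have "vs.span T \<subseteq> poly_span N T"
  proof (rule vs.span_minimal)
    show "T \<subseteq> poly_span N T" using poly_span_base[OF \<open>finite T\<close>] by blast
    show "vs.subspace (poly_span N T)"
      by (intro vs.subspaceI poly_span_0 poly_span_add poly_span_smul poly_ring_mconst)
  qed
  then show ?thesis using T \<open>finite T\<close> by blast
qed

text \<open>Below the least shift B is zero, each of the finitely many degrees up to
  \<open>D\<close> contributes finitely many generators, and above \<open>D\<close> elements are
  combinations of elements of lower degree.\<close>

lemma finite_homogeneous_generators:
  fixes B :: "(nat \<Rightarrow> (nat, 'k::field) mpoly) set"
  assumes B: "graded_submodule N b e B"
    and D: "\<And>a z. a > D \<Longrightarrow> z \<in> B \<Longrightarrow> homogeneous_vec b e a z \<Longrightarrow> z \<in> var_mult {1..N} B"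
  shows "\<exists>G. finite G \<and> G \<subseteq> B \<and> (\<forall>g\<in>G. \<exists>a. homogeneous_vec b e a g) \<and> B \<subseteq> poly_span N G"
proof -
  have BF: "B \<subseteq> free_module N b" using graded_submoduleD(1)[OF B] by blast
  have "\<forall>a. \<exists>T. finite T \<and> T \<subseteq> {z \<in> B. homogeneous_vec b e a z} \<and> {z \<in> B. homogeneous_vec b e a z} \<subseteq> poly_span N T"
    using homogeneous_part_finite_dimensional[OF BF] by blast
  then obtain T where T: "\<And>a. finite (T a)" "\<And>a. T a \<subseteq> {z \<in> B. homogeneous_vec b e a z}"
    "\<And>a. {z \<in> B. homogeneous_vec b e a z} \<subseteq> poly_span N (T a)"
    unfolding choice_iff by blast
  \<comment> \<open>Inserting 0 keeps the minimum defined for \<open>b = 0\<close>; any lower bound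
    of the shifts will do.\<close>
  define L where "L = Min (insert 0 (e ` {1..b}))"
  have L: "L \<le> e j" if "j \<in> {1..b}" for j unfolding L_def using that by (intro Min_le) auto
  define G where "G = (\<Union>a\<in>{L..D}. T a)"
  have TG: "poly_span N (T a) \<subseteq> poly_span N G" if "a \<in> {L..D}" for a
    using that T(1) by (intro poly_span_minimal subsetI poly_span_base) (auto simp: G_def)
  have low: "z = 0" if z: "z \<in> B" "homogeneous_vec b e a z" "a < L" for z a
  proof
    fix j
    show "z j = 0 j"
    proof (cases "j \<in> {1..b}")
      case True
      have "homogeneous (a - e j) (z j)" using z(2) True by (simp add: homogeneous_vec_def)
      then have "Poly_Mapping.keys (z j) = {}" using L[OF True] z(3) by (force simp: homogeneous_def)
      then show ?thesis by simp
    next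
      case False
      then show ?thesis using z(1) BF by (auto simp: free_module_def)
    qed
  qed
  have gen: "z \<in> poly_span N G" if "a < L + int k" "z \<in> B" "homogeneous_vec b e a z" for k a z
    using that
  proof (induction k arbitrary: a z)
    case 0
    then have "z = 0" by (intro low[of z a]) (simp_all only: of_nat_0 add_0_right)
    then show ?case by (simp only: poly_span_0)
  next
    case (Suc k)
    show ?case
    proof (cases "a < L + int k")
      case False
      then have a: "a = L + int k" using Suc.prems by simp
      show ?thesis
      proof (cases "a \<le> D")
        case True
        then have "a \<in> {L..D}" using a by simp
        moreover have "z \<in> poly_span N (T a)" using T(3)[of a] Suc.prems(2,3) by blast
        ultimately show ?thesis using TG[of a] by blast
      next
        case False
        then have "z \<in> var_mult {1..N} B" using Suc.prems(2,3) by (intro D[of a]) simp_all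
        then obtain g where g: "\<And>v. v \<in> {1..N} \<Longrightarrow> g v \<in> B" "z = (\<Sum>v\<in>{1..N}. smul (mvar v) (g v))"
          unfolding var_mult_def by blast
        \<comment> \<open>Passing to degree \<open>a\<close> components makes the coefficient
          vectors homogeneous of degree \<open>a - 1\<close>, where the induction hypothesis
          applies.\<close>
        have "z = hcomp_vec e (a - 1 + 1) z"
          using hcomp_vec_id[of z N b e a] Suc.prems(2,3) BF by (simp add: subset_iff)
        also have "\<dots> = (\<Sum>v\<in>{1..N}. smul (mvar v) (hcomp_vec e (a - 1) (g v)))"
          unfolding g(2) by (simp only: hcomp_vec_sum hcomp_vec_mvar)
        also have "\<dots> \<in> poly_span N G"
        proof (intro poly_span_sum poly_span_smul poly_ring_mvar)
          fix v assume v: "v \<in> {1..N}"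
          show "hcomp_vec e (a - 1) (g v) \<in> poly_span N G"
          proof (rule Suc.IH)
            show "a - 1 < L + int k" using a by simp
            show "hcomp_vec e (a - 1) (g v) \<in> B" by (rule graded_submoduleD(5)[OF B g(1)[OF v]])
          qed simp
        qed
        finally show ?thesis .
      qed
    next
      case True
      then show ?thesis using Suc.prems(2,3) by (rule Suc.IH)
    qed
  qed
  have "B \<subseteq> poly_span N G"
  proof
    fix z assume z: "z \<in> B"
    obtain A where A: "finite A" "(\<Sum>a\<in>A. hcomp_vec e a z) = z"
      using sum_hcomp_vec[of z N b e] z BF by blast
    have "(\<Sum>a\<in>A. hcomp_vec e a z) \<in> poly_span N G"
    proof (rule poly_span_sum)
      fix a
      have "a < L + int (nat (a - L + 1))" by linarith
      then show "hcomp_vec e a z \<in> poly_span N G"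
        using graded_submoduleD(5)[OF B z] by (rule gen) simp
    qed
    then show "z \<in> poly_span N G" using A by simp
  qed
  moreover have "finite G" using T(1) by (simp add: G_def)
  moreover have "G \<subseteq> B" "\<forall>g\<in>G. \<exists>a. homogeneous_vec b e a g" using T(2) by (auto simp: G_def)
  ultimately show ?thesis by blast
qed

text \<open>Take a finite homogeneous generating set of least cardinality. A relation in which some
  coefficient has a nonzero constant term could be solved for a generator, so all relations have
  coefficients in the irrelevant ideal.\<close>

lemma minimal_cover:
  fixes B :: "(nat \<Rightarrow> (nat, 'k::field) mpoly) set"
  assumes B: "graded_submodule N b e B"
    and D: "\<And>a z. a > D \<Longrightarrow> z \<in> B \<Longrightarrow> homogeneous_vec b e a z \<Longrightarrow> z \<in> var_mult {1..N} B"
  shows "\<exists>b' e' h. graded_hom N b' e' b e h \<and> h ` free_module N b' = B \<and>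
    {w \<in> free_module N b'. h w = 0} \<subseteq> var_submodule {1..N}"
proof -
  define P where "P G \<longleftrightarrow> finite G \<and> G \<subseteq> B \<and> (\<forall>g\<in>G. \<exists>a. homogeneous_vec b e a g) \<and> B \<subseteq> poly_span N G"
    for G
  have "\<exists>G. P G"
    unfolding P_def by (rule finite_homogeneous_generators[OF B]) (rule D)
  then obtain G0 where "P G0" ..
  from ex_has_least_nat[of P, OF this, of card]
  obtain G where PG: "P G" and min: "\<And>G'. P G' \<Longrightarrow> card G \<le> card G'" by blast
  have fin: "finite G" and GB: "G \<subseteq> B" and BG: "B \<subseteq> poly_span N G"
    and homG: "\<forall>g\<in>G. \<exists>a. homogeneous_vec b e a g"
    using PG unfolding P_def by blast+
  have irr: "g \<notin> poly_span N (G - {g})" if g: "g \<in> G" for g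
  proof
    assume "g \<in> poly_span N (G - {g})"
    then have "G \<subseteq> poly_span N (G - {g})" using poly_span_base[of "G - {g}"] fin by blast
    then have "B \<subseteq> poly_span N (G - {g})" using BG poly_span_minimal[of G N "G - {g}"] by blast
    then have "P (G - {g})" using fin GB homG unfolding P_def by blast
    then have "card G \<le> card (G - {g})" by (rule min)
    then show False using card_Diff1_less[OF fin g] by simp
  qed
  define b' where "b' = card G"
  obtain en where en: "bij_betw en {1..b'} G"
    using ex_bij_betw_nat_finite_1[OF fin] b'_def by blast
  have enG: "en j \<in> G" if "j \<in> {1..b'}" for j using bij_betwE[OF en] that by blast
  obtain e' where e': "\<And>j. j \<in> {1..b'} \<Longrightarrow> homogeneous_vec b e (e' j) (en j)"
    using homG enG bchoice[of "{1..b'}" "\<lambda>j a. homogeneous_vec b e a (en j)"] by blast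
  define h where "h w = (\<Sum>j\<in>{1..b'}. smul (w j) (en j))" for w :: "nat \<Rightarrow> (nat, 'k) mpoly"
  have hB: "h w \<in> B" if "w \<in> free_module N b'" for w
    unfolding h_def using free_module_apply[OF that] enG GB
    by (intro graded_submodule_sum[OF B] graded_submoduleD(4)[OF B]) auto
  have hom: "graded_hom N b' e' b e h"
    unfolding graded_hom_def
  proof (intro conjI ballI allI impI funcsetI)
    fix w :: "nat \<Rightarrow> (nat, 'k) mpoly" assume w: "w \<in> free_module N b'"
    show "h w \<in> free_module N b" using graded_submoduleD(1)[OF B hB[OF w]] .
    fix w' :: "nat \<Rightarrow> (nat, 'k) mpoly"
    show "h (\<lambda>j. w j + w' j) = (\<lambda>j. h w j + h w' j)"
      by (rule ext) (simp add: h_def sum_fun_apply sum.distrib algebra_simps)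
  next
    fix f :: "(nat, 'k) mpoly" and w :: "nat \<Rightarrow> (nat, 'k) mpoly"
    show "h (\<lambda>j. f * w j) = (\<lambda>j. f * h w j)"
      by (rule ext) (simp add: h_def sum_fun_apply sum_distrib_left mult.assoc)
  next
    fix w :: "nat \<Rightarrow> (nat, 'k) mpoly" and a assume w: "homogeneous_vec b' e' a w"
    show "homogeneous_vec b e a (h w)"
      unfolding h_def
    proof (rule homogeneous_vec_sum)
      fix j assume j: "j \<in> {1..b'}"
      have "homogeneous (a - e' j) (w j)" using w j by (simp add: homogeneous_vec_def)
      from homogeneous_vec_smul[OF this e'[OF j]]
      show "homogeneous_vec b e a (smul (w j) (en j))" by simp
    qed
  qed
  have "B \<subseteq> h ` free_module N b'"
  proof
    fix z assume "z \<in> B"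
    then obtain f where f: "\<forall>g\<in>G. f g \<in> poly_ring N" "z = (\<Sum>g\<in>G. smul (f g) g)"
      using BG by (auto simp: poly_span_def)
    define w where "w j = (if j \<in> {1..b'} then f (en j) else 0)" for j
    have "z = (\<Sum>j\<in>{1..b'}. smul (f (en j)) (en j))"
      unfolding f(2) by (rule sum.reindex_bij_betw[OF en, symmetric])
    also have "\<dots> = h w"
      unfolding h_def by (rule sum.cong) (simp_all add: w_def)
    finally have "z = h w" .
    moreover have "w \<in> free_module N b'" using f(1) enG by (auto simp: free_module_def w_def)
    ultimately show "z \<in> h ` free_module N b'" by blast
  qed
  then have im: "h ` free_module N b' = B" using hB by blast
  have "w j \<in> var_ideal {1..N}" if w: "w \<in> free_module N b'" "h w = 0" for w j
  proof (rule ccontr)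
    assume nj: "w j \<notin> var_ideal {1..N}"
    have j: "j \<in> {1..b'}"
    proof (rule ccontr)
      assume "j \<notin> {1..b'}"
      then have "w j = 0" using w(1) by (auto simp: free_module_def)
      then show False using nj by simp
    qed
    define c where "c = Poly_Mapping.lookup (w j) 0"
    have "c \<noteq> 0"
    proof
      assume "c = 0"
      then have "w j \<in> irrelevant_ideal N"
        using free_module_apply[OF w(1)] by (simp add: irrelevant_ideal_def c_def)
      then show False using nj by (simp add: irrelevant_ideal_eq)
    qed
    \<comment> \<open>In this component the coordinate at \<open>j\<close> has degree 0, hence is
      the invertible constant \<open>c\<close>.\<close>
    define w' where "w' = hcomp_vec e' (e' j) w"
    have w'F: "w' \<in> free_module N b'" unfolding w'_def by (rule hcomp_vec_free_module[OF w(1)])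
    have w'j: "w' j = mconst c"
      by (rule poly_mapping_eqI)
        (auto simp: w'_def hcomp_vec_def hcomp_def lookup_pfilter mconst_def lookup_single when_def
          c_def mon_degree_eq_0_iff)
    have "h w' = 0"
      using graded_hom_hcomp[OF hom w(1), of "e' j"] w(2) by (simp only: w'_def hcomp_vec_0)
    then have "0 = smul (w' j) (en j) + (\<Sum>i\<in>{1..b'} - {j}. smul (w' i) (en i))"
      unfolding h_def using sum.remove[OF finite_atLeastAtMost j, of "\<lambda>i. smul (w' i) (en i)"] by simp
    then have eq: "smul (mconst c) (en j) = - (\<Sum>i\<in>{1..b'} - {j}. smul (w' i) (en i))"
      unfolding w'j eq_neg_iff_add_eq_0 by (rule sym)
    have "(\<Sum>i\<in>{1..b'} - {j}. smul (w' i) (en i)) \<in> poly_span N (G - {en j})"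
    proof (intro poly_span_sum poly_span_smul poly_span_base)
      fix i assume i: "i \<in> {1..b'} - {j}"
      show "w' i \<in> poly_ring N" by (rule free_module_apply[OF w'F])
      have "en i \<noteq> en j" using en i j unfolding bij_betw_def inj_on_def by blast
      then show "en i \<in> G - {en j}" using enG i by blast
    qed (use fin in simp)
    from poly_span_smul[OF _ this, of "mconst (- inverse c)"]
    have "smul (mconst (- inverse c)) (\<Sum>i\<in>{1..b'} - {j}. smul (w' i) (en i)) \<in> poly_span N (G - {en j})"
      by simp
    moreover have "smul (mconst (- inverse c)) (\<Sum>i\<in>{1..b'} - {j}. smul (w' i) (en i))
        = smul (mconst (inverse c)) (smul (mconst c) (en j))"
      unfolding eq by (rule ext) (simp add: mconst_def single_uminus)
    moreover have "smul (mconst (inverse c)) (smul (mconst c) (en j)) = en j"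
      using left_inverse[OF \<open>c \<noteq> 0\<close>] by (simp only: smul_smul mconst_mult[symmetric] mconst_1 smul_one_left)
    ultimately show False using irr[OF enG[OF j]] by (simp only:)
  qed
  then have "{w \<in> free_module N b'. h w = 0} \<subseteq> var_submodule {1..N}"
    by (auto simp: var_submodule_def)
  then show ?thesis using hom im by blast
qed

subsection \<open>Existence of minimal graded free resolutions\<close>

text \<open>Minimal covers of successive kernels; the chain passed along supplies the degree bound
  that each cover requires.\<close>

lemma minimal_resolution_exists:
  fixes I :: "(nat, 'k::field) mpoly set"
  assumes xs: "bij_betw xs {..<N} {1..N}"
    and B0: "graded_submodule N 1 (\<lambda>_. 0) {w \<in> free_module N 1. w 1 \<in> I}" "I \<subseteq> var_ideal {1..N}"
    and Q0: "regular_chain N xs c r 0 1 (\<lambda>_. 0) {w \<in> free_module N 1. w 1 \<in> I}"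
  shows "\<exists>p \<beta> e d. minimal_graded_free_resolution N I p \<beta> e d"
proof -
  let ?B0 = "{w \<in> free_module N 1. w 1 \<in> I}"
  \<comment> \<open>The clause for \<open>i = 0\<close> pins the initial state, since dependent
    choice only promises some state satisfying \<open>P 0\<close>.\<close>
  define P :: "nat \<Rightarrow> nat \<times> (nat \<Rightarrow> int) \<times> (nat \<Rightarrow> (nat, 'k) mpoly) set \<Rightarrow> bool" where
    "P = (\<lambda>i (b, e, B). graded_submodule N b e B \<and> B \<subseteq> var_submodule {1..N} \<and>
       regular_chain N xs c r i b e B \<and> (i = 0 \<longrightarrow> b = 1 \<and> e = (\<lambda>_. 0) \<and> B = ?B0))"
  define Q :: "nat \<times> (nat \<Rightarrow> int) \<times> (nat \<Rightarrow> (nat, 'k) mpoly) set \<Rightarrow>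
      nat \<times> (nat \<Rightarrow> int) \<times> (nat \<Rightarrow> (nat, 'k) mpoly) set \<Rightarrow> bool" where
    "Q = (\<lambda>(b, e, B) (b', e', B'). \<exists>h. graded_hom N b' e' b e h \<and> h ` free_module N b' = B \<and>
       B' = {w \<in> free_module N b'. h w = 0})"
  have "?B0 \<subseteq> var_submodule {1..N}"
  proof
    fix w assume w: "w \<in> ?B0"
    have "w j \<in> var_ideal {1..N}" for j
      using w B0(2) by (cases "j = 1") (auto simp: free_module_def)
    then show "w \<in> var_submodule {1..N}" by (simp add: var_submodule_def)
  qed
  then have "P 0 (1, (\<lambda>_. 0), ?B0)" using B0 Q0 by (simp add: P_def)
  moreover have "\<exists>y. P (Suc i) y \<and> Q x y" if Px: "P i x" for x i
  proof -
    obtain b e B where x: "x = (b, e, B)" by (metis prod_cases3)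
    have B: "graded_submodule N b e B" "B \<subseteq> var_submodule {1..N}" "regular_chain N xs c r i b e B"
      using Px by (auto simp: P_def x)
    have "z \<in> var_mult {1..N} B"
      if "a > r + int i + 1" "z \<in> B" "homogeneous_vec b e a z" for a z
      using regular_chain_tor[OF xs B(1,3) order_refl, of a] that B(2)
      unfolding xs_all[OF xs] tor_vanishes_at_def by blast
    then have "\<exists>b' e' h. graded_hom N b' e' b e h \<and> h ` free_module N b' = B \<and>
        {w \<in> free_module N b'. h w = 0} \<subseteq> var_submodule {1..N}"
      by (rule minimal_cover[OF B(1)])
    then obtain b' e' h where h: "graded_hom N b' e' b e h" "h ` free_module N b' = B"
      "{w \<in> free_module N b'. h w = 0} \<subseteq> var_submodule {1..N}" by blast
    have "P (Suc i) (b', e', {w \<in> free_module N b'. h w = 0})"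
      using graded_submodule_kernel[OF h(1)] h(3) regular_chain_kernel[OF xs h(1,2) B(3)]
      by (simp add: P_def)
    moreover have "Q x (b', e', {w \<in> free_module N b'. h w = 0})"
      unfolding Q_def x using h by auto
    ultimately show ?thesis by blast
  qed
  ultimately obtain F where F: "\<And>i. P i (F i)" "\<And>i. Q (F i) (F (Suc i))"
    using dependent_nat_choice[of P "\<lambda>_. Q"] by blast
  define \<beta> e B where "\<beta> i = fst (F i)" and "e i = fst (snd (F i))" and "B i = snd (snd (F i))" for i
  have Fi: "F i = (\<beta> i, e i, B i)" for i by (simp add: \<beta>_def e_def B_def)
  have PB: "graded_submodule N (\<beta> i) (e i) (B i)" "B i \<subseteq> var_submodule {1..N}"
    "regular_chain N xs c r i (\<beta> i) (e i) (B i)" for i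
    using F(1)[of i] by (auto simp: Fi P_def)
  have init: "\<beta> 0 = 1" "e 0 = (\<lambda>_. 0)" "B 0 = ?B0" using F(1)[of 0] by (auto simp: Fi P_def)
  have "\<forall>i. \<exists>h. graded_hom N (\<beta> (Suc i)) (e (Suc i)) (\<beta> i) (e i) h \<and> h ` free_module N (\<beta> (Suc i)) = B i \<and>
      B (Suc i) = {w \<in> free_module N (\<beta> (Suc i)). h w = 0}"
    using F(2) by (simp add: Fi Q_def)
  from choice[OF this] obtain h where
    hh: "\<forall>i. graded_hom N (\<beta> (Suc i)) (e (Suc i)) (\<beta> i) (e i) (h i) \<and> h i ` free_module N (\<beta> (Suc i)) = B i \<and>
      B (Suc i) = {w \<in> free_module N (\<beta> (Suc i)). h i w = 0}" ..
  note h = hh[THEN spec, THEN conjunct1] hh[THEN spec, THEN conjunct2, THEN conjunct1]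
    hh[THEN spec, THEN conjunct2, THEN conjunct2]
  \<comment> \<open>\<open>h i\<close> has source F_(i+1), whereas \<open>d i\<close> has to start
    at F_i.\<close>
  define d where "d i = h (i - 1)" for i
  \<comment> \<open>After N steps all variables are covered by the regular part of the chain, so
    Tor_1 with the irrelevant ideal vanishes in every degree.\<close>
  have zero: "\<beta> i = 0" if i: "i > N" for i
  proof (rule ccontr)
    assume "\<beta> i \<noteq> 0"
    obtain i' where i': "i = Suc i'" using i by (cases i) auto
    have "tor_vanishes_at (\<beta> i') (e i') {1..N} (B i') a" for a
      using regular_chain_tor[OF xs PB(1,3) order_refl] i i' unfolding xs_all[OF xs] by simp
    moreover have "w \<in> var_submodule {1..N}" if "w \<in> free_module N (\<beta> (Suc i'))" "h i' w = 0" for w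
      using that h(3)[of i'] PB(2)[of "Suc i'"] by blast
    ultimately show False
      using no_generator_in_degree[OF h(1) h(2) PB(2), of i' "e i 1" 1] i' \<open>\<beta> i \<noteq> 0\<close> by auto
  qed
  have "minimal_graded_free_resolution N I N \<beta> e d"
    unfolding minimal_graded_free_resolution_def
  proof (intro conjI allI impI ballI)
    show "\<beta> 0 = 1" "e 0 1 = 0" by (simp_all add: init)
    show "\<beta> i = 0" if "N < i" for i using zero that .
    show "graded_hom N (\<beta> i) (e i) (\<beta> (i - 1)) (e (i - 1)) (d i)" if "1 \<le> i" for i
      using h(1)[of "i - 1"] that by (simp add: d_def)
    show "d 1 ` free_module N (\<beta> 1) = ?B0" using h(2)[of 0] by (simp add: d_def init)
    show "d (i + 1) ` free_module N (\<beta> (i + 1)) = {w \<in> free_module N (\<beta> i). d i w = (\<lambda>j. 0)}" if "1 \<le> i" for i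
      using h(2)[of i] h(3)[of "i - 1"] that by (simp add: d_def zero_fun_def)
    show "d i w j \<in> irrelevant_ideal N" if "1 \<le> i" "w \<in> free_module N (\<beta> i)" "j \<in> {1..\<beta> (i - 1)}" for i w j
    proof -
      have "d i w \<in> B (i - 1)" using h(2)[of "i - 1"] that by (auto simp: d_def)
      then show ?thesis
        using PB(2)[of "i - 1"] free_module_apply[OF graded_submoduleD(1)[OF PB(1)]]
        by (auto simp: irrelevant_ideal_eq var_submodule_def)
    qed
  qed
  then show ?thesis by blast
qed

subsection \<open>Toric ideals\<close>

text \<open>What is needed of a monomial map: multiplication by a monomial preserves and reflects
  fibres, and each fibre lies in one degree, which makes the ideal graded.\<close>

locale fibre_map =
  fixes N :: nat and \<phi> :: "(nat \<Rightarrow>\<^sub>0 nat) \<Rightarrow> 's"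
  assumes cancel: "\<phi> (u + t) = \<phi> (u + t') \<longleftrightarrow> \<phi> t = \<phi> t'"
    and degree_eq: "\<phi> t = \<phi> t' \<Longrightarrow> mon_degree t = mon_degree t'"
begin

text \<open>The coefficient at \<open>s\<close> of the image of \<open>f\<close> in the semigroup
  algebra of the values of \<open>\<phi>\<close>.\<close>

definition fibre_sum :: "(nat, 'k::field) mpoly \<Rightarrow> 's \<Rightarrow> 'k" where
  "fibre_sum f s = (\<Sum>t\<in>Poly_Mapping.keys f. if \<phi> t = s then Poly_Mapping.lookup f t else 0)"

definition toric_ideal :: "(nat, 'k::field) mpoly set" where
  "toric_ideal = {f \<in> poly_ring N. \<forall>s. fibre_sum f s = 0}"

text \<open>A monomial in the N variables with value \<open>s\<close> is zero in the toric ring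
  modulo \<open>X\<close> exactly when \<open>s\<close> is hit.\<close>

definition hit :: "nat set \<Rightarrow> 's \<Rightarrow> bool" where
  "hit X s \<longleftrightarrow> (\<exists>t. Poly_Mapping.keys t \<subseteq> {1..N} \<and> \<phi> t = s \<and> (\<exists>v\<in>X. Poly_Mapping.lookup t v \<noteq> 0))"

lemma fibre_sum_superset:
  assumes "finite A" "Poly_Mapping.keys f \<subseteq> A"
  shows "fibre_sum f s = (\<Sum>t\<in>A. if \<phi> t = s then Poly_Mapping.lookup f t else 0)"
  unfolding fibre_sum_def using assms by (intro sum.mono_neutral_left) (auto simp: in_keys_iff)

lemma fibre_sum_0 [simp]: "fibre_sum 0 s = 0"
  by (simp add: fibre_sum_def)

lemma fibre_sum_add: "fibre_sum (f + g) s = fibre_sum f s + fibre_sum g s"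
proof -
  let ?A = "Poly_Mapping.keys f \<union> Poly_Mapping.keys g"
  have "Poly_Mapping.keys (f + g) \<subseteq> ?A" by (rule keys_add)
  then show ?thesis
    by (simp add: fibre_sum_superset[of ?A] sum.distrib[symmetric] lookup_add if_distrib cong: if_cong)
qed

lemma fibre_sum_uminus: "fibre_sum (- f) s = - fibre_sum f s"
  using fibre_sum_add[of "- f" f s] by (simp add: eq_neg_iff_add_eq_0)

lemma fibre_sum_diff: "fibre_sum (f - g) s = fibre_sum f s - fibre_sum g s"
  using fibre_sum_add[of f "- g" s] by (simp add: fibre_sum_uminus)

lemma fibre_sum_sum: "fibre_sum (sum f A) s = (\<Sum>i\<in>A. fibre_sum (f i) s)"
  by (induction A rule: infinite_finite_induct) (auto simp: fibre_sum_add)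

lemma fibre_sum_single: "fibre_sum (Poly_Mapping.single t c) s = (if \<phi> t = s then c else 0)"
  by (subst fibre_sum_superset[of "{t}"]) auto

lemma fibre_sum_eq_0: "(\<And>t. t \<in> Poly_Mapping.keys f \<Longrightarrow> \<phi> t \<noteq> s) \<Longrightarrow> fibre_sum f s = 0"
  by (simp add: fibre_sum_def)

lemma fibre_sum_single_mult:
  "fibre_sum (Poly_Mapping.single u c * f) (\<phi> (u + t0)) = c * fibre_sum f (\<phi> t0)"
proof -
  have "fibre_sum (Poly_Mapping.single u c * f) (\<phi> (u + t0)) = (\<Sum>t\<in>(+) u ` Poly_Mapping.keys f.
      if \<phi> t = \<phi> (u + t0) then Poly_Mapping.lookup (Poly_Mapping.single u c * f) t else 0)"
    by (rule fibre_sum_superset) (simp_all add: keys_single_mult)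
  also have "\<dots> = (\<Sum>t\<in>Poly_Mapping.keys f. if \<phi> (u + t) = \<phi> (u + t0)
      then Poly_Mapping.lookup (Poly_Mapping.single u c * f) (u + t) else 0)"
    by (subst sum.reindex) (simp_all add: inj_on_def)
  also have "\<dots> = (\<Sum>t\<in>Poly_Mapping.keys f. c * (if \<phi> t = \<phi> t0 then Poly_Mapping.lookup f t else 0))"
    by (rule sum.cong) (simp_all add: cancel lookup_single_mult)
  finally show ?thesis by (simp add: fibre_sum_def sum_distrib_left)
qed

lemma fibre_sum_mvar_mult: "fibre_sum (mvar v * f) (\<phi> (Poly_Mapping.single v 1 + t0)) = fibre_sum f (\<phi> t0)"
  unfolding mvar_def by (simp only: fibre_sum_single_mult mult_1)

lemma toric_ideal_add: "f \<in> toric_ideal \<Longrightarrow> g \<in> toric_ideal \<Longrightarrow> f + g \<in> toric_ideal"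
  by (simp add: toric_ideal_def poly_ring_add fibre_sum_add)

lemma toric_ideal_mult:
  assumes g: "g \<in> poly_ring N" and f: "f \<in> toric_ideal"
  shows "g * f \<in> toric_ideal"
proof -
  have "fibre_sum (g * f) s = 0" for s
  proof -
    have "g * f = (\<Sum>u\<in>Poly_Mapping.keys g. Poly_Mapping.single u (Poly_Mapping.lookup g u)) * f"
      using pfilter_split[of "\<lambda>_. True" g] by (simp add: pfilter_def)
    also have "fibre_sum \<dots> s = (\<Sum>u\<in>Poly_Mapping.keys g. fibre_sum (Poly_Mapping.single u (Poly_Mapping.lookup g u) * f) s)"
      by (simp add: sum_distrib_right fibre_sum_sum)
    also have "\<dots> = 0"
    proof (rule sum.neutral, rule ballI)
      fix u
      let ?p = "Poly_Mapping.single u (Poly_Mapping.lookup g u) * f"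
      show "fibre_sum ?p s = 0"
      proof (cases "\<exists>t0. s = \<phi> (u + t0)")
        case True
        then show ?thesis using f by (auto simp: fibre_sum_single_mult toric_ideal_def)
      next
        \<comment> \<open>A fibre that is not the translate of one by \<open>u\<close> contains no
          term of the product.\<close>
        case False
        then show ?thesis
          using keys_single_mult[of u "Poly_Mapping.lookup g u" f] by (intro fibre_sum_eq_0) blast
      qed
    qed
    finally show ?thesis .
  qed
  then show ?thesis using g f by (simp add: toric_ideal_def poly_ring_mult)
qed

text \<open>By \<open>degree_eq\<close> a homogeneous component keeps the whole sum over a fibre or
  none of it.\<close>

lemma toric_ideal_hcomp:
  assumes "f \<in> toric_ideal"
  shows "hcomp a f \<in> toric_ideal"
proof -
  have "fibre_sum (hcomp a f) s = 0" for s
  proof (cases "\<exists>t0. \<phi> t0 = s \<and> int (mon_degree t0) = a")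
    case True
    then obtain t0 where t0: "\<phi> t0 = s" "int (mon_degree t0) = a" by blast
    have "fibre_sum (hcomp a f) s
        = (\<Sum>t\<in>Poly_Mapping.keys f. if \<phi> t = s then Poly_Mapping.lookup (hcomp a f) t else 0)"
      by (rule fibre_sum_superset) (simp_all add: hcomp_def keys_pfilter Collect_restrict)
    also have "\<dots> = fibre_sum f s"
      unfolding fibre_sum_def
    proof (rule sum.cong[OF refl])
      fix t
      have "\<phi> t = s \<Longrightarrow> int (mon_degree t) = a" using t0 degree_eq[of t t0] by simp
      then show "(if \<phi> t = s then Poly_Mapping.lookup (hcomp a f) t else 0)
          = (if \<phi> t = s then Poly_Mapping.lookup f t else 0)"
        by (simp add: hcomp_def lookup_pfilter)
    qed
    finally have "fibre_sum (hcomp a f) s = fibre_sum f s" .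
    then show ?thesis using assms by (simp add: toric_ideal_def)
  next
    case False
    then show ?thesis by (intro fibre_sum_eq_0) (auto simp: hcomp_def keys_pfilter)
  qed
  then show ?thesis using assms by (simp add: toric_ideal_def poly_ring_hcomp)
qed

text \<open>Forward, an element of the variable ideal has no term in a fibre that is not hit.
  Backward, each term in a hit fibre is moved within its fibre to a monomial divisible by a variable
  of \<open>X\<close>; these moved terms form \<open>q\<close>.\<close>

lemma toric_ideal_mod_iff:
  fixes f :: "(nat, 'k::field) mpoly"
  assumes f: "f \<in> poly_ring N"
  shows "(\<exists>y\<in>toric_ideal. f - y \<in> var_ideal X) \<longleftrightarrow> (\<forall>s. \<not> hit X s \<longrightarrow> fibre_sum f s = 0)"
proof
  assume "\<exists>y\<in>toric_ideal. f - y \<in> var_ideal X"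
  then obtain y where y: "y \<in> toric_ideal" "f - y \<in> var_ideal X" by blast
  have yR: "y \<in> poly_ring N" using y(1) by (simp add: toric_ideal_def)
  show "\<forall>s. \<not> hit X s \<longrightarrow> fibre_sum f s = 0"
  proof (intro allI impI)
    fix s assume s: "\<not> hit X s"
    have "fibre_sum (f - y) s = 0"
    proof (rule fibre_sum_eq_0)
      fix t assume t: "t \<in> Poly_Mapping.keys (f - y)"
      have "Poly_Mapping.keys t \<subseteq> {1..N}" using poly_ring_diff[OF f yR] t by (simp add: poly_ring_def)
      moreover have "\<exists>v\<in>X. Poly_Mapping.lookup t v \<noteq> 0" using y(2) t unfolding var_ideal_def by blast
      ultimately show "\<phi> t \<noteq> s" using s unfolding hit_def by blast
    qed
    then show "fibre_sum f s = 0" using y(1) by (simp add: fibre_sum_diff toric_ideal_def)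
  qed
next
  assume *: "\<forall>s. \<not> hit X s \<longrightarrow> fibre_sum f s = 0"
  have "\<forall>s. \<exists>t. hit X s \<longrightarrow> Poly_Mapping.keys t \<subseteq> {1..N} \<and> \<phi> t = s \<and> (\<exists>v\<in>X. Poly_Mapping.lookup t v \<noteq> 0)"
    by (auto simp: hit_def)
  from choice[OF this] obtain rep where
    rep: "\<forall>s. hit X s \<longrightarrow> Poly_Mapping.keys (rep s) \<subseteq> {1..N} \<and> \<phi> (rep s) = s \<and> (\<exists>v\<in>X. Poly_Mapping.lookup (rep s) v \<noteq> 0)" ..
  define A where "A = {t \<in> Poly_Mapping.keys f. hit X (\<phi> t)}"
  define q where "q = (\<Sum>t\<in>A. Poly_Mapping.single (rep (\<phi> t)) (Poly_Mapping.lookup f t))"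
  have fin: "finite A" by (simp add: A_def)
  have "q \<in> var_ideal X"
    unfolding q_def using rep by (intro var_ideal_sum) (auto simp: var_ideal_def A_def)
  moreover have "f - q \<in> toric_ideal"
  proof -
    have "q \<in> poly_ring N"
      unfolding q_def using rep by (intro poly_ring_sum) (auto simp: poly_ring_def A_def)
    moreover have "fibre_sum (f - q) s = 0" for s
    proof -
      have "fibre_sum q s = (\<Sum>t\<in>A. if \<phi> (rep (\<phi> t)) = s then Poly_Mapping.lookup f t else 0)"
        by (simp add: q_def fibre_sum_sum fibre_sum_single)
      also have "\<dots> = (\<Sum>t\<in>A. if \<phi> t = s then Poly_Mapping.lookup f t else 0)"
        using rep by (intro sum.cong) (auto simp: A_def)
      also have "\<dots> = (if hit X s then fibre_sum f s else 0)"
      proof (cases "hit X s")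
        case True
        then show ?thesis unfolding fibre_sum_def A_def
          using True by (auto intro!: sum.mono_neutral_left split: if_splits)
      next
        case False
        then show ?thesis by (auto simp: A_def intro!: sum.neutral)
      qed
      finally show ?thesis using * by (simp add: fibre_sum_diff)
    qed
    ultimately show ?thesis using f by (simp add: toric_ideal_def poly_ring_diff)
  qed
  ultimately show "\<exists>y\<in>toric_ideal. f - y \<in> var_ideal X" by (intro bexI[of _ "f - q"]) simp_all
qed

text \<open>The ideal inside R^1, in the form in which a resolution has it as the image of
  \<open>d 1\<close>.\<close>

abbreviation toric_vec :: "(nat \<Rightarrow> (nat, 'k::field) mpoly) set" where
  "toric_vec \<equiv> {w \<in> free_module N 1. w 1 \<in> toric_ideal}"

lemma graded_submodule_toric: "graded_submodule N 1 (\<lambda>_. 0) toric_vec"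
  unfolding graded_submodule_def
proof (intro conjI ballI allI)
  show "0 \<in> toric_vec" by (simp add: toric_ideal_def)
qed (auto simp: free_module_add free_module_smul hcomp_vec_free_module toric_ideal_add
      toric_ideal_mult toric_ideal_hcomp hcomp_vec_apply)

lemma toric_vec_mod_iff:
  assumes z: "z \<in> free_module N 1"
  shows "(\<exists>y\<in>toric_vec. z - y \<in> var_submodule X) \<longleftrightarrow> (\<forall>s. \<not> hit X s \<longrightarrow> fibre_sum (z 1) s = 0)"
proof -
  have "(\<exists>y\<in>toric_vec. z - y \<in> var_submodule X) \<longleftrightarrow> (\<exists>y\<in>toric_ideal. z 1 - y \<in> var_ideal X)"
  proof
    assume "\<exists>y\<in>toric_ideal. z 1 - y \<in> var_ideal X"
    then obtain y where y: "y \<in> toric_ideal" "z 1 - y \<in> var_ideal X" by blast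
    let ?y = "\<lambda>j. if j = 1 then y else 0"
    have "?y \<in> toric_vec" using y(1) by (auto simp: free_module_def toric_ideal_def)
    moreover have "z - ?y \<in> var_submodule X"
      unfolding var_submodule_def
    proof (intro CollectI allI)
      fix j
      show "(z - ?y) j \<in> var_ideal X"
        using y(2) z by (cases "j = 1") (auto simp: free_module_def)
    qed
    ultimately show "\<exists>y\<in>toric_vec. z - y \<in> var_submodule X" by blast
  qed (auto simp: var_submodule_def)
  then show ?thesis using toric_ideal_mod_iff[OF free_module_apply[OF z]] by simp
qed

section \<open>Regularity of variables in terms of fibres\<close>

text \<open>The fibre sum of \<open>x z\<close> over the fibre of \<open>x t\<close> is that of
  \<open>z\<close> over the fibre of \<open>t\<close>. So injectivity follows if no fibre of degree
  \<open>a\<close> becomes hit only after multiplication by \<open>x\<close>.\<close>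

lemma regular_at_toricI:
  assumes x: "x \<in> {1..N}" and e: "e 1 = 0"
    and unhit: "\<And>t. Poly_Mapping.keys t \<subseteq> {1..N} \<Longrightarrow> int (mon_degree t) = a \<Longrightarrow>
      hit X (\<phi> (Poly_Mapping.single x 1 + t)) \<Longrightarrow> hit X (\<phi> t)"
  shows "regular_at N 1 e X x (toric_vec :: (nat \<Rightarrow> (nat, 'k::field) mpoly) set) a"
  unfolding regular_at_def
proof (intro ballI impI)
  fix z :: "nat \<Rightarrow> (nat, 'k) mpoly" assume z: "z \<in> free_module N 1" "homogeneous_vec 1 e a z"
    and "\<exists>y\<in>toric_vec. smul (mvar x) z - y \<in> var_submodule X"
  then have *: "\<forall>s. \<not> hit X s \<longrightarrow> fibre_sum (mvar x * z 1) s = 0"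
    using toric_vec_mod_iff[OF free_module_smul[OF z(1) poly_ring_mvar[OF x]]] by simp
  have "fibre_sum (z 1) s = 0" if s: "\<not> hit X s" for s
  proof (cases "\<exists>t\<in>Poly_Mapping.keys (z 1). \<phi> t = s")
    case True
    then obtain t where t: "t \<in> Poly_Mapping.keys (z 1)" "\<phi> t = s" by blast
    have "Poly_Mapping.keys t \<subseteq> {1..N}" using free_module_apply[OF z(1)] t by (simp add: poly_ring_def)
    moreover have "int (mon_degree t) = a" using z(2) e t by (simp add: homogeneous_vec_def homogeneous_def)
    ultimately have "\<not> hit X (\<phi> (Poly_Mapping.single x 1 + t))" using unhit s t by blast
    then have "fibre_sum (mvar x * z 1) (\<phi> (Poly_Mapping.single x 1 + t)) = 0" using * by blast
    then show ?thesis unfolding fibre_sum_mvar_mult using t by simp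
  next
    case False
    then show ?thesis by (intro fibre_sum_eq_0) blast
  qed
  then show "\<exists>y\<in>toric_vec. z - y \<in> var_submodule X" using toric_vec_mod_iff[OF z(1)] by blast
qed

text \<open>Conversely, a fibre that becomes hit provides a monomial with nonzero class that is
  killed by \<open>x\<close>.\<close>

lemma not_regular_at_toricI:
  assumes x: "x \<in> {1..N}" and e: "e 1 = 0"
    and t: "Poly_Mapping.keys t \<subseteq> {1..N}" "int (mon_degree t) = a" "\<not> hit X (\<phi> t)"
      "hit X (\<phi> (Poly_Mapping.single x 1 + t))"
  shows "\<not> regular_at N 1 e X x (toric_vec :: (nat \<Rightarrow> (nat, 'k::field) mpoly) set) a"
proof
  assume reg: "regular_at N 1 e X x (toric_vec :: (nat \<Rightarrow> (nat, 'k) mpoly) set) a"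
  define z :: "nat \<Rightarrow> (nat, 'k) mpoly" where "z j = (if j = 1 then Poly_Mapping.single t 1 else 0)" for j
  have z: "z \<in> free_module N 1" "homogeneous_vec 1 e a z"
    using t e by (auto simp: z_def free_module_def poly_ring_def homogeneous_vec_def homogeneous_def)
  have "fibre_sum (mvar x * z 1) s = 0" if "\<not> hit X s" for s
  proof -
    have "mvar x * z 1 = Poly_Mapping.single (Poly_Mapping.single x 1 + t) 1"
      by (simp add: z_def mvar_def mult_single)
    moreover have "\<phi> (Poly_Mapping.single x 1 + t) \<noteq> s" using that t(4) by blast
    ultimately show ?thesis by (simp add: fibre_sum_single)
  qed
  then have "\<exists>y\<in>toric_vec. smul (mvar x) z - y \<in> var_submodule X"
    using toric_vec_mod_iff[OF free_module_smul[OF z(1) poly_ring_mvar[OF x]]] by simp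
  then have "\<exists>y\<in>toric_vec. z - y \<in> var_submodule X"
    using reg z unfolding regular_at_def by blast
  then have "fibre_sum (z 1) (\<phi> t) = 0" using toric_vec_mod_iff[OF z(1)] t(3) by blast
  then show False by (simp add: z_def fibre_sum_single)
qed

lemma hit_iff:
  assumes "X \<subseteq> {1..N}"
  shows "hit X s \<longleftrightarrow> (\<exists>v\<in>X. \<exists>t. Poly_Mapping.keys t \<subseteq> {1..N} \<and> \<phi> (Poly_Mapping.single v 1 + t) = s)"
proof
  assume "hit X s"
  then obtain t v where t: "Poly_Mapping.keys t \<subseteq> {1..N}" "\<phi> t = s" "v \<in> X" "Poly_Mapping.lookup t v \<noteq> 0"
    by (auto simp: hit_def)
  have eq: "Poly_Mapping.single v 1 + (t - Poly_Mapping.single v 1) = t" by (rule single_1_add_diff[OF t(4)])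
  have "Poly_Mapping.keys (t - Poly_Mapping.single v 1) \<subseteq> {1..N}"
    using t(1) keys_add_nat[of "Poly_Mapping.single v 1" "t - Poly_Mapping.single v 1"] unfolding eq by blast
  then show "\<exists>v\<in>X. \<exists>t. Poly_Mapping.keys t \<subseteq> {1..N} \<and> \<phi> (Poly_Mapping.single v 1 + t) = s"
    using eq t by metis
next
  assume "\<exists>v\<in>X. \<exists>t. Poly_Mapping.keys t \<subseteq> {1..N} \<and> \<phi> (Poly_Mapping.single v 1 + t) = s"
  then obtain v t where t: "v \<in> X" "Poly_Mapping.keys t \<subseteq> {1..N}" "\<phi> (Poly_Mapping.single v 1 + t) = s" by blast
  have "Poly_Mapping.keys (Poly_Mapping.single v 1 + t) \<subseteq> {1..N}"
    using t assms by (auto simp: keys_add_nat)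
  moreover have "Poly_Mapping.lookup (Poly_Mapping.single v 1 + t) v \<noteq> 0" by (simp add: lookup_add)
  ultimately show "hit X s" using t unfolding hit_def by blast
qed

lemma hit_mono: "X \<subseteq> Y \<Longrightarrow> hit X s \<Longrightarrow> hit Y s"
  unfolding hit_def by blast

text \<open>1 is the only monomial of degree 0, so it is alone in its fibre and the constant
  coefficient is a fibre sum.\<close>

lemma toric_ideal_subset_var_ideal: "toric_ideal \<subseteq> var_ideal {1..N}"
proof
  fix f :: "(nat, 'a) mpoly" assume f: "f \<in> toric_ideal"
  have "Poly_Mapping.lookup f 0 = fibre_sum f (\<phi> 0)"
  proof -
    have "\<phi> t = \<phi> 0 \<longleftrightarrow> t = 0" for t
      using degree_eq[of t 0] by (auto simp: mon_degree_eq_0_iff)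
    then show ?thesis by (simp add: fibre_sum_def in_keys_iff)
  qed
  then have "f \<in> irrelevant_ideal N" using f by (simp add: irrelevant_ideal_def toric_ideal_def)
  then show "f \<in> var_ideal {1..N}" by (simp add: irrelevant_ideal_eq)
qed

end

subsection \<open>The ideal of a monomial curve\<close>

definition weight :: "('v \<Rightarrow> nat) \<Rightarrow> ('v \<Rightarrow>\<^sub>0 nat) \<Rightarrow> nat" where
  "weight c t = (\<Sum>v\<in>Poly_Mapping.keys t. c v * Poly_Mapping.lookup t v)"

lemma weight_eq_sum:
  assumes "finite A" "Poly_Mapping.keys t \<subseteq> A"
  shows "weight c t = (\<Sum>v\<in>A. c v * Poly_Mapping.lookup t v)"
  unfolding weight_def using assms
  by (intro sum.mono_neutral_left) (auto simp: in_keys_iff)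

lemma weight_add: "weight c (s + t) = weight c s + weight c t"
proof -
  let ?A = "Poly_Mapping.keys s \<union> Poly_Mapping.keys t"
  have "weight c (s + t) = (\<Sum>v\<in>?A. c v * Poly_Mapping.lookup (s + t) v)"
    by (rule weight_eq_sum) (use keys_add[of s t] in auto)
  then show ?thesis
    by (simp add: lookup_add distrib_left sum.distrib weight_eq_sum[of ?A])
qed

lemma weight_single [simp]: "weight c (Poly_Mapping.single v k) = c v * k"
  by (simp add: weight_def)

lemma weight_0 [simp]: "weight c 0 = 0"
  by (simp add: weight_def)

lemma mvar_power: "mvar v ^ k = Poly_Mapping.single (Poly_Mapping.single v k) 1"
proof (induction k)
  case (Suc k)
  have "Poly_Mapping.single v 1 + Poly_Mapping.single v k = Poly_Mapping.single v (Suc k)"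
    by (simp add: single_add[symmetric])
  then show ?case unfolding power_Suc Suc.IH by (simp only: mvar_def mult_single mult_1)
qed simp

lemma prod_single_1:
  "(\<Prod>v\<in>A. Poly_Mapping.single (a v) 1) = Poly_Mapping.single (\<Sum>v\<in>A. a v) (1 :: 'k::comm_ring_1)"
  by (induction A rule: infinite_finite_induct) (simp_all add: mult_single)

lemma single_power_1:
  "Poly_Mapping.single a (1 :: 'k::comm_ring_1) ^ k = Poly_Mapping.single (\<Sum>i<k. a) 1"
  using prod_single_1[of "\<lambda>_. a" "{..<k}"] by simp

text \<open>Degree and exponent of \<open>u\<close>; they determine the exponent of \<open>v\<close>
  as \<open>m n\<close> times the degree minus the weight.\<close>

definition curve_weight :: "nat \<Rightarrow> (nat \<Rightarrow> nat) \<Rightarrow> (nat \<Rightarrow>\<^sub>0 nat) \<Rightarrow> nat \<times> nat" where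
  "curve_weight n m t = (mon_degree t, weight (\<lambda>v. if v = n + 1 then 0 else m v) t)"

lemma curve_weight_add:
  "curve_weight n m (s + t) = (fst (curve_weight n m s) + fst (curve_weight n m t),
     snd (curve_weight n m s) + snd (curve_weight n m t))"
  by (simp add: curve_weight_def mon_degree_add weight_add)

lemma fibre_map_curve_weight: "fibre_map (curve_weight n m)"
  by unfold_locales (auto simp: curve_weight_def mon_degree_add weight_add)

text \<open>Monomials go to monomials, with exponent \<open>\<psi> t\<close>. The bound on
  \<open>m i\<close> makes the truncated subtraction in the exponent of \<open>v\<close>
  exact.\<close>

lemma curve_hom_eq:
  fixes f :: "(nat, 'k::field) mpoly"
  assumes f: "f \<in> poly_ring (n + 1)" and m: "\<And>i. i \<in> {1..n} \<Longrightarrow> m i \<le> m n"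
  shows "\<exists>\<psi>. curve_hom n m f = (\<Sum>t\<in>Poly_Mapping.keys f. Poly_Mapping.single (\<psi> t) (Poly_Mapping.lookup f t))
    \<and> (\<forall>t. Poly_Mapping.keys t \<subseteq> {1..n+1} \<longrightarrow> Poly_Mapping.lookup (\<psi> t) U = snd (curve_weight n m t)
       \<and> Poly_Mapping.lookup (\<psi> t) U + Poly_Mapping.lookup (\<psi> t) V = m n * mon_degree t)"
proof -
  define g :: "nat \<Rightarrow> (uv, 'k) mpoly"
    where "g = (\<lambda>i. if i = n + 1 then mvar V ^ m n else mvar U ^ m i * mvar V ^ (m n - m i))"
  define a :: "nat \<Rightarrow> uv \<Rightarrow>\<^sub>0 nat"
    where "a i = (if i = n + 1 then Poly_Mapping.single V (m n)
      else Poly_Mapping.single U (m i) + Poly_Mapping.single V (m n - m i))" for i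
  have g: "g i = Poly_Mapping.single (a i) 1" for i
    by (simp add: g_def a_def mvar_power mult_single)
  define \<psi> where "\<psi> t = (\<Sum>v\<in>Poly_Mapping.keys t. \<Sum>i<Poly_Mapping.lookup t v. a v)" for t :: "nat \<Rightarrow>\<^sub>0 nat"
  have "curve_hom n m f = (\<Sum>t\<in>Poly_Mapping.keys f. Poly_Mapping.single (\<psi> t) (Poly_Mapping.lookup f t))"
    unfolding curve_hom_def subst_hom_def g_def[symmetric] g single_power_1 prod_single_1 \<psi>_def
    by (simp add: mconst_def mult_single)
  moreover have "Poly_Mapping.lookup (\<psi> t) U = snd (curve_weight n m t)" for t
    by (auto simp: \<psi>_def curve_weight_def weight_def lookup_sum a_def lookup_add lookup_single intro!: sum.cong)
  moreover have "Poly_Mapping.lookup (\<psi> t) U + Poly_Mapping.lookup (\<psi> t) V = m n * mon_degree t"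
    if t: "Poly_Mapping.keys t \<subseteq> {1..n+1}" for t
  proof -
    have "Poly_Mapping.lookup (\<psi> t) U + Poly_Mapping.lookup (\<psi> t) V
        = (\<Sum>v\<in>Poly_Mapping.keys t. Poly_Mapping.lookup t v * (Poly_Mapping.lookup (a v) U + Poly_Mapping.lookup (a v) V))"
      by (simp add: \<psi>_def lookup_sum sum.distrib distrib_left)
    also have "\<dots> = (\<Sum>v\<in>Poly_Mapping.keys t. Poly_Mapping.lookup t v * m n)"
    proof (rule sum.cong[OF refl])
      fix v assume "v \<in> Poly_Mapping.keys t"
      then have "v \<in> {1..n+1}" using t by blast
      then have "v = n + 1 \<or> m v \<le> m n" using m[of v] by (cases "v = n + 1") auto
      then show "Poly_Mapping.lookup t v * (Poly_Mapping.lookup (a v) U + Poly_Mapping.lookup (a v) V)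
          = Poly_Mapping.lookup t v * m n"
        by (auto simp: a_def lookup_add lookup_single)
    qed
    finally show ?thesis by (simp add: mon_degree_def sum_distrib_left mult.commute)
  qed
  ultimately show ?thesis by blast
qed

lemma uv_poly_mapping_eq_iff:
  "q = q' \<longleftrightarrow> Poly_Mapping.lookup q U = Poly_Mapping.lookup q' U \<and> Poly_Mapping.lookup q V = Poly_Mapping.lookup q' V"
proof
  assume *: "Poly_Mapping.lookup q U = Poly_Mapping.lookup q' U \<and> Poly_Mapping.lookup q V = Poly_Mapping.lookup q' V"
  show "q = q'"
  proof (rule poly_mapping_eqI)
    fix k
    show "Poly_Mapping.lookup q k = Poly_Mapping.lookup q' k" using * by (cases k) simp_all
  qed
qed simp

text \<open>As \<open>m n > 0\<close>, two monomials have the same image iff they have the same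
  \<open>curve_weight\<close>; the coefficients of the image are therefore the fibre sums.\<close>

lemma vanishing_ideal_eq_toric_ideal:
  assumes m: "\<And>i. i \<in> {1..n} \<Longrightarrow> m i \<le> m n" "m n > 0"
  shows "vanishing_ideal n m = fibre_map.toric_ideal (n + 1) (curve_weight n m)"
proof -
  interpret fibre_map "n + 1" "curve_weight n m" by (rule fibre_map_curve_weight)
  have "curve_hom n m f = 0 \<longleftrightarrow> (\<forall>s. fibre_sum f s = 0)" if f: "f \<in> poly_ring (n + 1)"
    for f :: "(nat, 'a) mpoly"
  proof -
    obtain \<psi> where \<psi>: "curve_hom n m f = (\<Sum>t\<in>Poly_Mapping.keys f. Poly_Mapping.single (\<psi> t) (Poly_Mapping.lookup f t))"
      "\<And>t. Poly_Mapping.keys t \<subseteq> {1..n+1} \<Longrightarrow> Poly_Mapping.lookup (\<psi> t) U = snd (curve_weight n m t)"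
      "\<And>t. Poly_Mapping.keys t \<subseteq> {1..n+1} \<Longrightarrow>
         Poly_Mapping.lookup (\<psi> t) U + Poly_Mapping.lookup (\<psi> t) V = m n * mon_degree t"
      using curve_hom_eq[of f n m, OF f m(1)] by blast
    have supp: "Poly_Mapping.keys t \<subseteq> {1..n+1}" if "t \<in> Poly_Mapping.keys f" for t
      using f that by (simp add: poly_ring_def)
    have eq: "\<psi> t = \<psi> t' \<longleftrightarrow> curve_weight n m t = curve_weight n m t'"
      if t: "t \<in> Poly_Mapping.keys f" "t' \<in> Poly_Mapping.keys f" for t t'
    proof -
      have "\<psi> t = \<psi> t' \<longleftrightarrow> snd (curve_weight n m t) = snd (curve_weight n m t') \<and> m n * mon_degree t = m n * mon_degree t'"
        using \<psi>(2,3)[OF supp[OF t(1)]] \<psi>(2,3)[OF supp[OF t(2)]] by (auto simp: uv_poly_mapping_eq_iff)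
      then show ?thesis using m(2) by (auto simp: curve_weight_def)
    qed
    have lk: "Poly_Mapping.lookup (curve_hom n m f) q
        = (\<Sum>t\<in>Poly_Mapping.keys f. if \<psi> t = q then Poly_Mapping.lookup f t else 0)" for q
      by (simp add: \<psi>(1) lookup_sum lookup_single when_def)
    have same: "Poly_Mapping.lookup (curve_hom n m f) (\<psi> t) = fibre_sum f (curve_weight n m t)"
      if "t \<in> Poly_Mapping.keys f" for t
      unfolding lk fibre_sum_def using eq that by (intro sum.cong) auto
    show ?thesis
    proof
      assume z: "curve_hom n m f = 0"
      show "\<forall>s. fibre_sum f s = 0"
      proof
        fix s
        show "fibre_sum f s = 0"
        proof (cases "\<exists>t\<in>Poly_Mapping.keys f. curve_weight n m t = s")
          case True
          then show ?thesis using same z by auto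
        next
          case False
          then show ?thesis by (intro fibre_sum_eq_0) blast
        qed
      qed
    next
      assume z: "\<forall>s. fibre_sum f s = 0"
      show "curve_hom n m f = 0"
      proof (rule poly_mapping_eqI)
        fix q
        show "Poly_Mapping.lookup (curve_hom n m f) q = Poly_Mapping.lookup 0 q"
        proof (cases "\<exists>t\<in>Poly_Mapping.keys f. \<psi> t = q")
          case True
          then show ?thesis using same z by auto
        next
          case False
          then show ?thesis unfolding lk by (auto intro!: sum.neutral)
        qed
      qed
    qed
  qed
  then show ?thesis unfolding vanishing_ideal_def toric_ideal_def by blast
qed

subsection \<open>Arithmetic sequences\<close>

text \<open>The degree and weight pairs of the monomials, where \<open>\<nu> = n - 1\<close> and \<open>\<mu> = m 1\<close>.\<close>
definition in_semigroup :: "nat \<Rightarrow> nat \<Rightarrow> nat \<Rightarrow> nat \<Rightarrow> nat \<Rightarrow> bool" where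
  "in_semigroup \<nu> \<mu> d \<delta> w \<longleftrightarrow> (\<exists>k q. k \<le> \<delta> \<and> q \<le> k * \<nu> \<and> w = k * \<mu> + q * d)"

lemma in_semigroupI: "k \<le> \<delta> \<Longrightarrow> q \<le> k * \<nu> \<Longrightarrow> in_semigroup \<nu> \<mu> d \<delta> (k * \<mu> + q * d)"
  by (auto simp: in_semigroup_def)

text \<open>Regularity of x_n modulo x_(n+1). If \<open>w\<close> uses all \<open>\<delta>\<close>
  factors, the other representation has no more factors yet exceeds it by m_n, which forces
  \<open>q' > \<nu>\<close>; a copy of x_n can be removed from it.\<close>

lemma in_semigroup_cancel:
  assumes "in_semigroup \<nu> \<mu> d \<delta> w" "in_semigroup \<nu> \<mu> d \<delta> (w + (\<mu> + \<nu> * d))" and \<mu>: "\<mu> > 0"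
  shows "\<delta> \<ge> 1 \<and> in_semigroup \<nu> \<mu> d (\<delta> - 1) w"
proof -
  obtain k q where kq: "k \<le> \<delta>" "q \<le> k * \<nu>" "w = k * \<mu> + q * d"
    using assms(1) by (auto simp: in_semigroup_def)
  show ?thesis
  proof (cases "k < \<delta>")
    case True
    then show ?thesis using in_semigroupI[of k "\<delta> - 1" q \<nu> \<mu> d] kq by simp
  next
    case False
    then have k: "k = \<delta>" using kq by simp
    obtain k' q' where kq': "k' \<le> \<delta>" "q' \<le> k' * \<nu>" "w + (\<mu> + \<nu> * d) = k' * \<mu> + q' * d"
      using assms(2) by (auto simp: in_semigroup_def)
    have "k' * \<mu> \<le> \<delta> * \<mu>" using kq'(1) by (rule mult_right_mono) simp
    moreover have "\<delta> * \<mu> + q * d + \<mu> + \<nu> * d = k' * \<mu> + q' * d" using kq' kq k by simp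
    ultimately have "\<nu> * d < q' * d" using \<mu> by linarith
    then have q': "\<nu> < q'" by simp
    then have "k' \<noteq> 0" using kq'(2) by (cases k') auto
    then obtain j where j: "k' = Suc j" by (cases k') auto
    obtain p where p: "q' = \<nu> + p" using q' less_imp_add_positive by metis
    have "w = j * \<mu> + p * d" using kq'(3) unfolding j p by (simp add: algebra_simps)
    moreover have "p \<le> j * \<nu>" using kq'(2) unfolding j p by simp
    moreover have "j \<le> \<delta> - 1" "\<delta> \<ge> 1" using kq'(1) j by auto
    ultimately show ?thesis unfolding in_semigroup_def by blast
  qed
qed

text \<open>Fewer than \<open>\<delta>\<close> factors leave room for x_(n+1), and
  \<open>q \<ge> \<nu>\<close> lets x_n be split off. Otherwise \<open>d\<close> units of
  \<open>k\<close> are traded for \<open>\<mu>\<close> units of \<open>q\<close>; the bound on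
  \<open>\<delta>\<close> is what the worst case \<open>q = \<nu> - 1\<close> requires.\<close>

lemma in_semigroup_above:
  assumes w: "in_semigroup \<nu> \<mu> d \<delta> w" and \<delta>: "\<delta> * \<nu> \<ge> \<mu> + \<nu> * d + \<nu> - 1" "\<delta> \<ge> 1" and d: "d > 0" and \<nu>: "\<nu> > 0"
  shows "in_semigroup \<nu> \<mu> d (\<delta> - 1) w \<or>
    (\<exists>w'. w = w' + (\<mu> + \<nu> * d) \<and> in_semigroup \<nu> \<mu> d (\<delta> - 1) w')"
proof -
  obtain k q where kq: "k \<le> \<delta>" "q \<le> k * \<nu>" "w = k * \<mu> + q * d"
    using w by (auto simp: in_semigroup_def)
  consider "k < \<delta>" | "k = \<delta>" "q \<ge> \<nu>" | "k = \<delta>" "q < \<nu>" using kq(1) by linarith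
  then show ?thesis
  proof cases
    case 1
    then show ?thesis using in_semigroupI[of k "\<delta> - 1" q \<nu> \<mu> d] kq by simp
  next
    case 2
    obtain j where j: "\<delta> = Suc j" using \<delta>(2) by (cases \<delta>) auto
    obtain p where p: "q = \<nu> + p" using 2(2) le_Suc_ex by blast
    have "w = (j * \<mu> + p * d) + (\<mu> + \<nu> * d)" using kq(3) 2(1) unfolding j p by (simp add: algebra_simps)
    moreover have "p \<le> j * \<nu>" using kq(2) 2(1) unfolding j p by simp
    ultimately show ?thesis unfolding in_semigroup_def j by auto
  next
    case 3
    have ge: "q + \<mu> + \<nu> * d \<le> \<delta> * \<nu>" using \<delta>(1) 3(2) by linarith
    then have "\<nu> * d \<le> \<delta> * \<nu>" by linarith
    then have "d * \<nu> \<le> \<delta> * \<nu>" by (simp only: mult.commute[of \<nu> d])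
    then have "d \<le> \<delta>" using \<nu> by simp
    then obtain j where j: "\<delta> = d + j" using le_Suc_ex by blast
    have "w = j * \<mu> + (q + \<mu>) * d" using kq(3) 3(1) unfolding j by (simp add: algebra_simps)
    moreover have "q + \<mu> \<le> j * \<nu>" using ge unfolding j by (simp add: algebra_simps)
    moreover have "j \<le> \<delta> - 1" using j d by simp
    ultimately show ?thesis unfolding in_semigroup_def by blast
  qed
qed

text \<open>Every exchange that preserves the weight is a multiple of the basic one,
  \<open>d\<close> units of \<open>k\<close> for \<open>\<mu>\<close> units of
  \<open>q\<close>.\<close>

lemma semigroup_gap_degree:
  fixes \<mu> d a b :: nat
  assumes "coprime \<mu> d" "a * \<mu> = b * d" "b > 0" "\<mu> > 0" "d > 0"
  obtains l where "l \<ge> 1" "a = d * l" "b = \<mu> * l"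
proof -
  have "d dvd a"
    using assms(1,2) by (metis coprime_commute coprime_dvd_mult_left_iff dvd_triv_right)
  then obtain l where l: "a = d * l" by blast
  have "b = \<mu> * l" using assms(2,5) unfolding l by (simp add: ac_simps)
  moreover have "l \<noteq> 0" using calculation assms(3) by (cases l) auto
  ultimately show thesis using that[of l] l by simp
qed

text \<open>Divisibility of the element with \<open>k = r\<close>, \<open>q = \<nu> - 1\<close> by
  x_(n+1) or x_n would require a representation that differs by at least one exchange, and already
  one exchange violates \<open>q \<le> k * \<nu>\<close> under the bound on
  \<open>r\<close>.\<close>

lemma not_in_semigroup_top:
  assumes cop: "coprime \<mu> d" and pos: "\<mu> > 0" "\<nu> > 0" "d > 0" and r: "r * \<nu> + 2 \<le> \<mu> + \<nu> * d + \<nu>" "r \<ge> 1"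
  shows "\<not> in_semigroup \<nu> \<mu> d (r - 1) (r * \<mu> + (\<nu> - 1) * d)"
    and "r * \<mu> + (\<nu> - 1) * d = w' + (\<mu> + \<nu> * d) \<Longrightarrow> \<not> in_semigroup \<nu> \<mu> d (r - 1) w'"
proof -
  show "\<not> in_semigroup \<nu> \<mu> d (r - 1) (r * \<mu> + (\<nu> - 1) * d)"
  proof
    assume "in_semigroup \<nu> \<mu> d (r - 1) (r * \<mu> + (\<nu> - 1) * d)"
    then obtain k q where kq: "k \<le> r - 1" "q \<le> k * \<nu>" "r * \<mu> + (\<nu> - 1) * d = k * \<mu> + q * d"
      by (auto simp: in_semigroup_def)
    have "k < r" using kq(1) r(2) by simp
    then obtain a where a: "r = k + a" "a > 0" using less_imp_add_positive by metis
    have eq: "a * \<mu> + (\<nu> - 1) * d = q * d" using kq(3) unfolding a(1) by (simp add: algebra_simps)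
    have "0 < a * \<mu>" using a pos by simp
    then have "(\<nu> - 1) * d < q * d" using eq by linarith
    then have "\<nu> - 1 < q" by simp
    then obtain b where b: "q = (\<nu> - 1) + b" "b > 0" using less_imp_add_positive by metis
    have "a * \<mu> = b * d" using eq unfolding b(1) by (simp add: algebra_simps)
    from semigroup_gap_degree[OF cop this b(2) pos(1,3)]
    obtain l where l: "l \<ge> 1" "a = d * l" "b = \<mu> * l" .
    have "(\<nu> - 1) + \<mu> * l + d * l * \<nu> \<le> r * \<nu>"
      using kq(2) unfolding a(1) b l by (simp add: algebra_simps)
    moreover have "\<mu> * 1 \<le> \<mu> * l" "\<nu> * d * 1 \<le> \<nu> * d * l" using l(1) by (intro mult_le_mono2; simp)+
    moreover have "d * l * \<nu> = \<nu> * d * l" by simp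
    ultimately show False using r(1) pos(2) by linarith
  qed
  assume eq: "r * \<mu> + (\<nu> - 1) * d = w' + (\<mu> + \<nu> * d)"
  show "\<not> in_semigroup \<nu> \<mu> d (r - 1) w'"
  proof
    assume "in_semigroup \<nu> \<mu> d (r - 1) w'"
    then obtain k q where kq: "k \<le> r - 1" "q \<le> k * \<nu>" "w' = k * \<mu> + q * d"
      by (auto simp: in_semigroup_def)
    have "Suc k \<le> r" using kq(1) r(2) by simp
    then obtain a where a: "r = Suc k + a" using le_Suc_ex by blast
    obtain \<nu>' where \<nu>': "\<nu> = Suc \<nu>'" using pos(2) by (cases \<nu>) auto
    \<comment> \<open>Putting x_n back turns \<open>q\<close> into \<open>q + \<nu>\<close>;
      subtracting \<open>\<nu> - 1\<close> leaves \<open>q + 1\<close>.\<close>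
    have "a * \<mu> = (q + 1) * d" using eq unfolding kq(3) a \<nu>' by (simp add: algebra_simps)
    from semigroup_gap_degree[OF cop this _ pos(1,3)]
    obtain l where l: "l \<ge> 1" "a = d * l" "q + 1 = \<mu> * l" by auto
    have "\<mu> * l + d * l * \<nu> + \<nu> \<le> r * \<nu> + 1"
      using kq(2) unfolding a l(2) l(3)[symmetric] by (simp add: algebra_simps)
    moreover have "\<mu> * 1 \<le> \<mu> * l" "\<nu> * d * 1 \<le> \<nu> * d * l" using l(1) by (intro mult_le_mono2; simp)+
    moreover have "d * l * \<nu> = \<nu> * d * l" by simp
    ultimately show False using r(1) by linarith
  qed
qed

text \<open>\<open>k\<close> counts the factors other than x_(n+1), and \<open>q\<close> sums their
  indices minus one. The converse builds a monomial greedily.\<close>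

lemma monomial_curve_weight_iff:
  assumes m: "\<And>i. i \<in> {1..n} \<Longrightarrow> m i = m 1 + (i - 1) * d" and n: "n \<ge> 2"
  shows "(\<exists>t. Poly_Mapping.keys t \<subseteq> {1..n+1} \<and> curve_weight n m t = (\<delta>, w)) \<longleftrightarrow> in_semigroup (n - 1) (m 1) d \<delta> w"
proof
  assume "\<exists>t. Poly_Mapping.keys t \<subseteq> {1..n+1} \<and> curve_weight n m t = (\<delta>, w)"
  then obtain t where t: "Poly_Mapping.keys t \<subseteq> {1..n+1}" "mon_degree t = \<delta>"
    "weight (\<lambda>v. if v = n + 1 then 0 else m v) t = w"
    by (auto simp: curve_weight_def)
  define k where "k = (\<Sum>i\<in>{1..n}. Poly_Mapping.lookup t i)"
  define q where "q = (\<Sum>i\<in>{1..n}. (i - 1) * Poly_Mapping.lookup t i)"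
  have split: "{1..n+1} = insert (n + 1) {1..n}" by auto
  have "\<delta> = (\<Sum>i\<in>{1..n+1}. Poly_Mapping.lookup t i)"
    using mon_degree_eq_sum[OF _ t(1)] t(2) by simp
  then have "k \<le> \<delta>" unfolding split k_def by simp
  have "w = (\<Sum>v\<in>{1..n+1}. (if v = n + 1 then 0 else m v) * Poly_Mapping.lookup t v)"
    using weight_eq_sum[OF _ t(1)] t(3) by simp
  also have "\<dots> = (\<Sum>v\<in>{1..n}. (if v = n + 1 then 0 else m v) * Poly_Mapping.lookup t v)"
    unfolding split by simp
  also have "\<dots> = (\<Sum>i\<in>{1..n}. Poly_Mapping.lookup t i * m 1 + (i - 1) * Poly_Mapping.lookup t i * d)"
  proof (rule sum.cong[OF refl])
    fix v assume v: "v \<in> {1..n}"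
    then have "(if v = n + 1 then 0 else m v) = m 1 + (v - 1) * d" using m[OF v] by simp
    then show "(if v = n + 1 then 0 else m v) * Poly_Mapping.lookup t v
        = Poly_Mapping.lookup t v * m 1 + (v - 1) * Poly_Mapping.lookup t v * d"
      by (simp only:) (simp add: algebra_simps)
  qed
  also have "\<dots> = k * m 1 + q * d"
    by (simp add: k_def q_def sum.distrib sum_distrib_right)
  finally have "w = k * m 1 + q * d" .
  moreover have "q \<le> k * (n - 1)"
    unfolding q_def k_def sum_distrib_right by (intro sum_mono) auto
  ultimately show "in_semigroup (n - 1) (m 1) d \<delta> w"
    using in_semigroupI[OF \<open>k \<le> \<delta>\<close>] by simp
next
  assume "in_semigroup (n - 1) (m 1) d \<delta> w"
  then show "\<exists>t. Poly_Mapping.keys t \<subseteq> {1..n+1} \<and> curve_weight n m t = (\<delta>, w)"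
  proof (induction \<delta> arbitrary: w)
    case 0
    then have "w = 0" by (auto simp: in_semigroup_def)
    then show ?case by (intro exI[of _ 0]) (simp add: curve_weight_def)
  next
    case (Suc \<delta>)
    obtain k q where kq: "k \<le> Suc \<delta>" "q \<le> k * (n - 1)" "w = k * m 1 + q * d"
      using Suc.prems by (auto simp: in_semigroup_def)
    show ?case
    proof (cases "k \<le> \<delta>")
      case True
      then obtain t where t: "Poly_Mapping.keys t \<subseteq> {1..n+1}" "curve_weight n m t = (\<delta>, w)"
        using Suc.IH[of w] in_semigroupI[of k \<delta> q "n - 1" "m 1" d] kq by blast
      \<comment> \<open>The spare factor is x_(n+1), which adds degree but no weight.\<close>
      show ?thesis
        by (rule exI[of _ "Poly_Mapping.single (n + 1) 1 + t"])
          (use t in \<open>auto simp: keys_add_nat curve_weight_def mon_degree_add weight_add\<close>)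
    next
      case False
      then have k: "k = Suc \<delta>" using kq(1) by simp
      \<comment> \<open>The variable that absorbs as much of \<open>q\<close> as possible, so that
        the rest is at most \<open>\<delta> * (n - 1)\<close>.\<close>
      define i where "i = 1 + min q (n - 1)"
      have i: "i \<in> {1..n}" using n by (auto simp: i_def)
      have mi: "m i = m 1 + min q (n - 1) * d" using m[OF i] by (simp add: i_def)
      obtain p where p: "q = min q (n - 1) + p" by (metis le_Suc_ex min.cobounded1)
      have "p \<le> \<delta> * (n - 1)" using kq(2) p unfolding k by (cases "q \<le> n - 1") auto
      then have "in_semigroup (n - 1) (m 1) d \<delta> (\<delta> * m 1 + p * d)" by (intro in_semigroupI) auto
      then obtain t where t: "Poly_Mapping.keys t \<subseteq> {1..n+1}" "curve_weight n m t = (\<delta>, \<delta> * m 1 + p * d)"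
        using Suc.IH by blast
      have "q * d = min q (n - 1) * d + p * d" by (subst p) (rule distrib_right)
      then have w: "w = m i + (\<delta> * m 1 + p * d)" using kq(3) unfolding k mi by simp
      show ?thesis
        by (rule exI[of _ "Poly_Mapping.single i 1 + t"])
          (use t i in \<open>auto simp: keys_add_nat curve_weight_def mon_degree_add weight_add w\<close>)
    qed
  qed
qed

text \<open>
  \<open>x\<^bsub>n+1\<^esub>, x\<^sub>n\<close> is a regular sequence on the coordinate ring, and modulo these two variables the ring is
  Artinian; so they are taken first.
\<close>
definition curve_vars :: "nat \<Rightarrow> nat \<Rightarrow> nat" where
  "curve_vars n s = (if s = 0 then n + 1 else if s = 1 then n else s - 1)"

lemma curve_vars_bij:
  assumes n: "n \<ge> 2"
  shows "bij_betw (curve_vars n) {..<n+1} {1..n+1}"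
proof (rule bij_betw_byWitness[where f' = "\<lambda>v. if v = n + 1 then 0 else if v = n then 1 else v + 1"])
  show "curve_vars n ` {..<n+1} \<subseteq> {1..n+1}" using n by (auto simp: curve_vars_def)
qed (use n in \<open>auto simp: curve_vars_def\<close>)

lemma curve_vars_initial:
  "curve_vars n ` {..<0} = {}" "curve_vars n ` {..<1} = {n + 1}" "curve_vars n ` {..<2} = {n + 1, n}"
  by (auto simp: curve_vars_def lessThan_Suc numeral_2_eq_2)

section \<open>Regularity of the variables on an arithmetic curve\<close>

context
  fixes n d :: nat and m :: "nat \<Rightarrow> nat"
  assumes n: "n \<ge> 2" and m1: "m 1 > 0" and d: "d > 0"
    and m: "\<And>i. i \<in> {1..n} \<Longrightarrow> m i = m 1 + (i - 1) * d"
begin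

interpretation fibre_map "n + 1" "curve_weight n m"
  by (rule fibre_map_curve_weight)

lemma m_n: "m n = m 1 + (n - 1) * d"
  using m[of n] n by simp

lemma hit_last_iff:
  "hit {n + 1} (\<delta>, w) \<longleftrightarrow> \<delta> \<ge> 1 \<and> in_semigroup (n - 1) (m 1) d (\<delta> - 1) w"
proof -
  have "curve_weight n m (Poly_Mapping.single (n + 1) 1 + t) = (\<delta>, w) \<longleftrightarrow> \<delta> \<ge> 1 \<and> curve_weight n m t = (\<delta> - 1, w)"
    for t
    unfolding curve_weight_add by (auto simp: curve_weight_def)
  then show ?thesis
    using hit_iff[of "{n + 1}" "(\<delta>, w)"] monomial_curve_weight_iff[OF m n, of "\<delta> - 1" w] by auto
qed

lemma hit_last_two_iff:
  "hit {n + 1, n} (\<delta>, w) \<longleftrightarrow> \<delta> \<ge> 1 \<and> (in_semigroup (n - 1) (m 1) d (\<delta> - 1) w \<or>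
     (\<exists>w'. w = w' + (m 1 + (n - 1) * d) \<and> in_semigroup (n - 1) (m 1) d (\<delta> - 1) w'))"
proof -
  have 1: "curve_weight n m (Poly_Mapping.single (n + 1) 1 + t) = (\<delta>, w) \<longleftrightarrow> \<delta> \<ge> 1 \<and> curve_weight n m t = (\<delta> - 1, w)"
    for t
    unfolding curve_weight_add by (auto simp: curve_weight_def)
  have 2: "curve_weight n m (Poly_Mapping.single n 1 + t) = (\<delta>, w) \<longleftrightarrow>
      \<delta> \<ge> 1 \<and> (\<exists>w'. w = w' + (m 1 + (n - 1) * d) \<and> curve_weight n m t = (\<delta> - 1, w'))"
    for t
    unfolding curve_weight_add using m_n by (auto simp: curve_weight_def)
  have S: "in_semigroup (n - 1) (m 1) d \<delta> w \<longleftrightarrow>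
      (\<exists>t. Poly_Mapping.keys t \<subseteq> {1..n+1} \<and> curve_weight n m t = (\<delta>, w))" for \<delta> w
    using monomial_curve_weight_iff[OF m n, of \<delta> w] by simp
  have "hit {n + 1, n} (\<delta>, w) \<longleftrightarrow>
      (\<exists>t. Poly_Mapping.keys t \<subseteq> {1..n+1} \<and> curve_weight n m (Poly_Mapping.single (n + 1) 1 + t) = (\<delta>, w)) \<or>
      (\<exists>t. Poly_Mapping.keys t \<subseteq> {1..n+1} \<and> curve_weight n m (Poly_Mapping.single n 1 + t) = (\<delta>, w))"
    using hit_iff[of "{n + 1, n}" "(\<delta>, w)"] n by auto
  then show ?thesis
    unfolding 1 2 by (simp only: S) blast
qed

lemma in_semigroup_curve_weight:
  "Poly_Mapping.keys t \<subseteq> {1..n+1} \<Longrightarrow> curve_weight n m t = (\<delta>, w) \<Longrightarrow> in_semigroup (n - 1) (m 1) d \<delta> w"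
  using monomial_curve_weight_iff[OF m n, of \<delta> w] by blast

text \<open>This floor equals the ceiling of (m_n - 1)/(n - 1). In this form it is the largest
  \<open>r\<close> within the bound of \<open>not_in_semigroup_top\<close>.\<close>

definition curve_reg :: nat where
  "curve_reg = (m n + n - 3) div (n - 1)"

text \<open>The first and third inequalities are the bounds in \<open>not_in_semigroup_top\<close>
  and \<open>in_semigroup_above\<close>; they are complementary, so the top degree is located
  exactly.\<close>

lemma curve_reg_bounds:
  "curve_reg * (n - 1) + 2 \<le> m 1 + (n - 1) * d + (n - 1)" "curve_reg \<ge> 1"
  "\<delta> > curve_reg \<Longrightarrow> \<delta> * (n - 1) \<ge> m 1 + (n - 1) * d + (n - 1) - 1"
proof -
  obtain \<nu> where \<nu>: "n = Suc \<nu>" "\<nu> > 0" using n by (cases n) auto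
  have "\<nu> * d \<ge> \<nu>" using d by simp
  \<comment> \<open>This rules out truncation in \<open>?M\<close> and makes the quotient at least
    1.\<close>
  then have ge: "m 1 + \<nu> * d \<ge> 1 + \<nu>" using m1 by linarith
  let ?M = "m 1 + \<nu> * d + \<nu> - 2"
  have r: "curve_reg = ?M div \<nu>" unfolding curve_reg_def m_n by (simp add: \<nu>(1) numeral_3_eq_3 numeral_2_eq_2)
  have "?M div \<nu> * \<nu> \<le> ?M" by (rule div_times_less_eq_dividend)
  then have "curve_reg * \<nu> + 2 \<le> m 1 + \<nu> * d + \<nu>"
    using ge \<nu>(2) unfolding r by linarith
  then show "curve_reg * (n - 1) + 2 \<le> m 1 + (n - 1) * d + (n - 1)"
    using \<nu>(1) by simp
  have "\<nu> \<le> ?M" using ge \<nu>(2) by linarith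
  then show "curve_reg \<ge> 1" unfolding r using \<nu>(2) by (simp add: Suc_le_eq div_greater_zero_iff)
  assume "\<delta> > curve_reg"
  then have "Suc (?M div \<nu>) * \<nu> \<le> \<delta> * \<nu>" unfolding r by (intro mult_le_mono1) simp
  moreover have "?M < Suc (?M div \<nu>) * \<nu>" using dividend_less_div_times[OF \<nu>(2), of ?M] by (simp add: add.commute)
  ultimately show "\<delta> * (n - 1) \<ge> m 1 + (n - 1) * d + (n - 1) - 1" using \<nu>(1) by simp
qed

text \<open>The quotient by x_(n+1) and x_n is zero above degree \<open>curve_reg\<close>.\<close>

lemma hit_above:
  assumes t: "Poly_Mapping.keys t \<subseteq> {1..n+1}" and deg: "mon_degree t > curve_reg"
  shows "hit {n + 1, n} (curve_weight n m t)"
proof -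
  obtain w where w: "curve_weight n m t = (mon_degree t, w)" by (simp add: curve_weight_def)
  show ?thesis
    unfolding w hit_last_two_iff
    using in_semigroup_above[OF in_semigroup_curve_weight[OF t w] curve_reg_bounds(3)[OF deg] _ d] deg n by simp
qed

text \<open>The hypothesis fixes only \<open>e 1\<close>, because a resolution leaves the other
  values of \<open>e 0\<close> open.\<close>

lemma regular_chain_curve:
  assumes e: "e 1 = 0"
  shows "regular_chain (n + 1) (curve_vars n) 2 (int curve_reg) 0 1 e (toric_vec :: (nat \<Rightarrow> (nat, 'k::field) mpoly) set)"
  unfolding regular_chain_def
proof (intro allI impI)
  fix s a assume s: "s < n + 1" and a: "s < 2 + 0 \<or> int curve_reg + int 0 < a"
  have x: "curve_vars n s \<in> {1..n+1}" using bij_betwE[OF curve_vars_bij[OF n]] s by blast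
  show "regular_at (n + 1) 1 e (curve_vars n ` {..<s}) (curve_vars n s) (toric_vec :: (nat \<Rightarrow> (nat, 'k) mpoly) set) a"
  proof (rule regular_at_toricI[where e = e, OF x e])
    fix t :: "nat \<Rightarrow>\<^sub>0 nat"
    assume t: "Poly_Mapping.keys t \<subseteq> {1..n+1}" "int (mon_degree t) = a"
      and hit: "hit (curve_vars n ` {..<s}) (curve_weight n m (Poly_Mapping.single (curve_vars n s) 1 + t))"
    consider "s = 0" | "s = 1" | "s \<ge> 2" by linarith
    then show "hit (curve_vars n ` {..<s}) (curve_weight n m t)"
    proof cases
      case 1
      \<comment> \<open>No fibre is hit by the empty set: variables are injective on the coordinate
        ring itself.\<close>
      then show ?thesis using hit unfolding 1 curve_vars_initial hit_def by blast
    next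
      case 2
      obtain w where w: "curve_weight n m t = (mon_degree t, w)" by (simp add: curve_weight_def)
      have "curve_weight n m (Poly_Mapping.single n 1 + t) = (mon_degree t + 1, w + (m 1 + (n - 1) * d))"
        unfolding curve_weight_add w by (simp add: curve_weight_def m_n)
      then have "in_semigroup (n - 1) (m 1) d (mon_degree t) (w + (m 1 + (n - 1) * d))"
        using hit hit_last_iff[of "mon_degree t + 1"] unfolding 2 curve_vars_initial by (simp add: curve_vars_def)
      from in_semigroup_cancel[OF in_semigroup_curve_weight[OF t(1) w] this m1]
      show ?thesis unfolding 2 curve_vars_initial w hit_last_iff .
    next
      case 3
      then have "mon_degree t > curve_reg" using a t(2) by simp
      from hit_above[OF t(1) this] show ?thesis
      proof (rule hit_mono[rotated])
        show "{n + 1, n} \<subseteq> curve_vars n ` {..<s}"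
          unfolding curve_vars_initial(3)[symmetric] using 3 by (intro image_mono) auto
      qed
    qed
  qed
qed

text \<open>A monomial of the top degree is nonzero modulo x_(n+1) and x_n. The next variable, x_1,
  kills it, since that quotient vanishes one degree higher.\<close>

lemma not_regular_at_curve:
  assumes e: "e 1 = 0" and cop: "coprime (m 1) d"
  shows "\<not> regular_at (n + 1) 1 e (curve_vars n ` {..<2}) (curve_vars n 2)
    (toric_vec :: (nat \<Rightarrow> (nat, 'k::field) mpoly) set) (int curve_reg)"
proof -
  let ?r = curve_reg
  \<comment> \<open>The coefficient of \<open>d\<close> is \<open>n - 2\<close>, the largest
    \<open>q\<close> for which x_n cannot be split off directly.\<close>
  let ?w = "?r * m 1 + (n - 1 - 1) * d"
  have \<nu>: "n - 1 > 0" using n by simp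
  have "1 * (n - 1) \<le> ?r * (n - 1)" by (rule mult_le_mono1[OF curve_reg_bounds(2)])
  then have "n - 1 - 1 \<le> ?r * (n - 1)" by linarith
  then have "in_semigroup (n - 1) (m 1) d ?r ?w" by (intro in_semigroupI) simp_all
  then obtain t where t: "Poly_Mapping.keys t \<subseteq> {1..n+1}" "curve_weight n m t = (?r, ?w)"
    using monomial_curve_weight_iff[OF m n] by blast
  have deg: "mon_degree t = ?r" using t(2) by (simp add: curve_weight_def)
  have "\<not> hit {n + 1, n} (curve_weight n m t)"
    unfolding t(2) hit_last_two_iff
    using not_in_semigroup_top[OF cop m1 \<nu> d curve_reg_bounds(1,2)] by blast
  moreover have "hit {n + 1, n} (curve_weight n m (Poly_Mapping.single 1 1 + t))"
  proof (rule hit_above)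
    show "Poly_Mapping.keys (Poly_Mapping.single 1 1 + t) \<subseteq> {1..n+1}" using t(1) n by (auto simp: keys_add_nat)
    show "mon_degree (Poly_Mapping.single 1 1 + t) > ?r" by (simp add: mon_degree_add deg)
  qed
  moreover have "curve_vars n 2 = 1" by (simp add: curve_vars_def)
  moreover have "(1::nat) \<in> {1..n+1}" by simp
  ultimately show ?thesis
    using not_regular_at_toricI[where e = e, OF _ e t(1), of 1 "int ?r" "{n + 1, n}"] deg unfolding curve_vars_initial by simp
qed

lemma curve_reg_ceiling: "int curve_reg = \<lceil>(real (m n) - 1) / (real n - 1)\<rceil>"
proof (rule ceiling_unique[symmetric])
  obtain \<nu> where \<nu>: "n = Suc \<nu>" "\<nu> > 0" using n by (cases n) auto
  have pos: "real n - 1 > 0" "real n - 1 = real \<nu>" using \<nu> by simp_all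
  have "curve_reg * \<nu> + 2 \<le> m n + \<nu>" using curve_reg_bounds(1) m_n \<nu>(1) by simp
  then have "real (curve_reg * \<nu> + 2) \<le> real (m n + \<nu>)" by (simp only: of_nat_le_iff)
  then have "(real curve_reg - 1) * real \<nu> < real (m n) - 1" by (simp add: algebra_simps)
  then show "of_int (int curve_reg) - 1 < (real (m n) - 1) / (real n - 1)"
    using pos \<nu>(2) by (simp add: less_divide_eq)
  have "Suc curve_reg * \<nu> \<ge> m n + \<nu> - 1" using curve_reg_bounds(3)[of "Suc curve_reg"] m_n \<nu>(1) by simp
  then have "m n \<le> curve_reg * \<nu> + 1" using \<nu>(2) by simp
  then have "real (m n) \<le> real (curve_reg * \<nu> + 1)" by (simp only: of_nat_le_iff)
  then have "real (m n) - 1 \<le> real curve_reg * real \<nu>" by simp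
  then show "(real (m n) - 1) / (real n - 1) \<le> of_int (int curve_reg)"
    using pos \<nu>(2) by (simp add: divide_le_eq)
qed

text \<open>Existence of a resolution and the common value of the maximum over all of them both come
  from the same regular chain.\<close>

lemma regularity_arithmetic_curve:
  assumes cop: "coprime (m 1) d"
  shows "regularity_quotient (n + 1) (vanishing_ideal n m :: (nat, 'k::field) mpoly set) = int curve_reg"
proof -
  have "m i \<le> m n" if "i \<in> {1..n}" for i
    unfolding m_n m[OF that] using that by (intro add_left_mono mult_le_mono1) auto
  moreover have "m n > 0" using m_n m1 by simp
  ultimately have I: "(vanishing_ideal n m :: (nat, 'k) mpoly set) = toric_ideal"
    by (rule vanishing_ideal_eq_toric_ideal)
  have Max: "Max {e i j - int i | i j. i \<in> {1..p} \<and> j \<in> {1..\<beta> i}} = int curve_reg"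
    if res: "minimal_graded_free_resolution (n + 1) (toric_ideal :: (nat, 'k) mpoly set) p \<beta> e D" for p \<beta> e D
  proof -
    have e: "e 0 1 = 0" using res unfolding minimal_graded_free_resolution_def by (elim conjE)
    show ?thesis
      using resolution_regularity[OF curve_vars_bij[OF n] res regular_chain_curve[where e = "e 0", OF e]
          not_regular_at_curve[where e = "e 0", OF e cop]] n
      by simp
  qed
  have "\<exists>p \<beta> e D. minimal_graded_free_resolution (n + 1) (toric_ideal :: (nat, 'k) mpoly set) p \<beta> e D"
    by (rule minimal_resolution_exists[OF curve_vars_bij[OF n] graded_submodule_toric
        toric_ideal_subset_var_ideal regular_chain_curve]) simp
  then obtain p \<beta> e D where
    res: "minimal_graded_free_resolution (n + 1) (toric_ideal :: (nat, 'k) mpoly set) p \<beta> e D"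
    by (elim exE)
  show ?thesis
    unfolding regularity_quotient_def I
  proof (rule the_equality)
    show "\<exists>p \<beta> e D. minimal_graded_free_resolution (n + 1) (toric_ideal :: (nat, 'k) mpoly set) p \<beta> e D \<and>
        int curve_reg = Max {e i j - int i | i j. i \<in> {1..p} \<and> j \<in> {1..\<beta> i}}"
      by (intro exI conjI, rule res, rule Max[OF res, symmetric])
  qed (elim exE conjE, simp only: Max)
qed

end

theorem theorem2p7:
  fixes n d :: nat and m :: "nat \<Rightarrow> nat"
  assumes "infinite (UNIV :: 'k::field set)"
    and "n \<ge> 2" and "m 1 > 0" and "d > 0"
    and "\<forall>i\<in>{1..n}. m i = m 1 + (i - 1) * d"
    and "gcd (m 1) d = 1"
  shows "regularity_quotient (n + 1) (vanishing_ideal n m :: (nat, 'k) mpoly set) =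
           \<lceil>(real (m n) - 1) / (real n - 1)\<rceil>"
proof -
  have m: "m i = m 1 + (i - 1) * d" if "i \<in> {1..n}" for i using assms(5) that by blast
  have cop: "coprime (m 1) d" using assms(6) by (simp add: coprime_iff_gcd_eq_1)
  show ?thesis
    using regularity_arithmetic_curve[of n m d, OF assms(2-4) m cop] curve_reg_ceiling[of n m d, OF assms(2-4) m]
    by simp
qed

end
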